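(* Let $E$ be an exceptional divisor on the blow up $X$ of $\mathbb{P}^2$ at $r=9$ generic points $p_i$. If $d_E=E\cdot L$ is even and each $m_i=E\cdot E_i$ $(1\le i\le 9)$ is odd, then $a_E\leq (d_E-2)/2$ and $\gamma_E\geq 2$.
   Context: Work over an algebraically closed field $K$ of arbitrary characteristic. The points $p_1,\dots,p_9\in\mathbb{P}^2$ are generic (in the usual sense: e.g. their affine coordinates are $18$ elements of $K$ algebraically independent over the prime field). Let $\pi:X\to\mathbb{P}^2$ be the blow up at $p_1,\dots,p_9$, $L$ the pullback to $X$ of a line, $E_i=\pi^{-1}(p_i)$; the classes of $L,E_1,\dots,E_9$ form a basis of the divisor class group of $X$, with $L^2=1$, $E_i^2=-1$ and all other products $0$. An exceptional divisor (exceptional curve) on $X$ is a smooth rational curve $E\subset X$ with $E^2=-1$. For a smooth rational curve $D\subset X$, the pullback of $\Omega_{\mathbb{P}^2}(1)$ to $D\cong\mathbb{P}^1$ via $\pi|_D$ is isomorphic to $\mathcal{O}_{\mathbb{P}^1}(-a_D)\oplus\mathcal{O}_{\mathbb{P}^1}(-b_D)$ with $0\le a_D\le b_D$ and $a_D+b_D=D\cdot L$; the splitting gap is $\gamma_D=b_D-a_D$. *)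

theory Defs
  imports "HOL-Analysis.Analysis"
begin

subsection \<open>Generic points\<close>

definition prime_subfield :: "'k::field set" where
  "prime_subfield = {of_int a / of_int b | a b. True}"

text \<open>A polynomial in the variables indexed by \<open>'i\<close> is given by its coefficients \<open>c e\<close>, for exponent
  vectors \<open>e\<close> ranging over a finite set \<open>S\<close>.\<close>

definition alg_independent_over :: "'k::field set \<Rightarrow> ('i::finite \<Rightarrow> 'k) \<Rightarrow> bool" where
  "alg_independent_over F z \<longleftrightarrow>
     (\<forall>(S :: ('i \<Rightarrow> nat) set) c.
        finite S \<and> (\<forall>e\<in>S. c e \<in> F) \<and> (\<Sum>e\<in>S. c e * (\<Prod>i\<in>UNIV. z i ^ e i)) = 0 \<longrightarrow>
        (\<forall>e\<in>S. c e = 0))"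

text \<open>The points are given by their affine coordinates in the chart \<open>(x : y : 1)\<close>.\<close>

definition generic_points :: "(9 \<Rightarrow> 'k::field ^ 2) \<Rightarrow> bool" where
  "generic_points p \<longleftrightarrow> alg_independent_over prime_subfield (\<lambda>(i :: 9, j :: 2). p i $ j)"

definition hom_coords :: "'k::field ^ 2 \<Rightarrow> 'k ^ 3" where
  "hom_coords q = vector [q $ 1, q $ 2, 1]"


subsection \<open>The blow-up\<close>

text \<open>A point of a projective space is a line through the origin, i.e. \<open>vec.span {v}\<close> with
  \<open>v \<noteq> 0\<close>. Vectors of the dual space are paired with vectors by \<open>pairing\<close>.\<close>

definition pairing :: "'k::field ^ 3 \<Rightarrow> 'k ^ 3 \<Rightarrow> 'k" where
  "pairing l x = (\<Sum>j\<in>UNIV. l $ j * x $ j)"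

type_synonym 'k blowup_point = "('k ^ 3) set \<times> (9 \<Rightarrow> ('k ^ 3) set)"

text \<open>The blow-up of the plane at one point \<open>p\<close> is the incidence variety of the pairs \<open>(x, l)\<close>,
  where \<open>l\<close> is a line (a point of the dual plane) through \<open>p\<close> and \<open>x\<close>; the blow-up at nine distinct
  points is the fibre product of the nine incidence varieties over the plane. The first component
  is the blow-down map \<open>\<pi>\<close>; the other components are the maps \<open>\<lambda>\<^sub>i\<close> to the pencils
  (projective lines) of lines through the points \<open>p\<^sub>i\<close>.\<close>

definition blowup :: "(9 \<Rightarrow> 'k::field ^ 2) \<Rightarrow> 'k blowup_point set" where
  "blowup p = {(x, l). \<exists>v. v \<noteq> 0 \<and> x = vec.span {v} \<and>
     (\<forall>i. \<exists>w. w \<noteq> 0 \<and> l i = vec.span {w} \<and> pairing w v = 0 \<and> pairing w (hom_coords (p i)) = 0)}"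


subsection \<open>Morphisms from the projective line\<close>

text \<open>A triple of binary forms of degree \<open>d\<close> in \<open>s, t\<close> is given by \<open>d\<close> and the dehomogenizations
  (at \<open>t = 1\<close>) of the forms, which are polynomials of degree at most \<open>d\<close>. At \<open>d\<close> itself the
  coefficient may vanish: the forms then vanish at \<open>(1 : 0)\<close>.\<close>

type_synonym 'k forms = "nat \<times> ('k poly ^ 3)"

definition is_forms :: "'k::field forms \<Rightarrow> bool" where
  "is_forms F \<longleftrightarrow> (\<forall>i. degree (snd F $ i) \<le> fst F)"

definition ev :: "'k::field forms \<Rightarrow> 'k ^ 2 \<Rightarrow> 'k ^ 3" where
  "ev F v = (\<chi> i. \<Sum>j\<le>fst F. coeff (snd F $ i) j * (v $ 1 ^ j * v $ 2 ^ (fst F - j)))"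

text \<open>The derivative at \<open>v\<close> in direction \<open>w\<close>: the coefficient of \<open>\<epsilon>\<close> in \<open>F (v + \<epsilon> w)\<close>.\<close>

definition dev :: "'k::field forms \<Rightarrow> 'k ^ 2 \<Rightarrow> 'k ^ 2 \<Rightarrow> 'k ^ 3" where
  "dev F v w = (\<chi> i. coeff (\<Sum>j\<le>fst F. smult (coeff (snd F $ i) j)
                       ([:v $ 1, w $ 1:] ^ j * [:v $ 2, w $ 2:] ^ (fst F - j))) 1)"

definition is_morphism :: "'k::field forms \<Rightarrow> bool" where
  "is_morphism F \<longleftrightarrow> is_forms F \<and> (\<forall>v. v \<noteq> 0 \<longrightarrow> ev F v \<noteq> 0)"

definition lin_indep2 :: "'k::field ^ 'n \<Rightarrow> 'k ^ 'n \<Rightarrow> bool" where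
  "lin_indep2 v w \<longleftrightarrow> (\<forall>a b. a *s v + b *s w = 0 \<longrightarrow> a = 0 \<and> b = 0)"

text \<open>A morphism from the projective line to the product of the plane and nine dual planes.\<close>

type_synonym 'k param = "'k forms \<times> (9 \<Rightarrow> 'k forms)"

definition param_point :: "'k::field param \<Rightarrow> 'k ^ 2 \<Rightarrow> 'k blowup_point" where
  "param_point \<phi> v = (vec.span {ev (fst \<phi>) v}, \<lambda>i. vec.span {ev (snd \<phi> i) v})"

definition param_image :: "'k::field param \<Rightarrow> 'k blowup_point set" where
  "param_image \<phi> = param_point \<phi> ` {v. v \<noteq> 0}"

text \<open>A closed immersion: a morphism that separates points and tangent vectors. The tangent map of
  \<open>v \<mapsto> [F v]\<close> is nonzero at \<open>[v]\<close> iff \<open>F v\<close> and the derivative of \<open>F\<close> at \<open>v\<close> in a direction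
  transversal to \<open>v\<close> are linearly independent.\<close>

definition closed_immersion :: "'k::field param \<Rightarrow> bool" where
  "closed_immersion \<phi> \<longleftrightarrow>
     is_morphism (fst \<phi>) \<and> (\<forall>i. is_morphism (snd \<phi> i)) \<and>
     (\<forall>u v. u \<noteq> 0 \<and> v \<noteq> 0 \<and> param_point \<phi> u = param_point \<phi> v \<longrightarrow> vec.span {u} = vec.span {v}) \<and>
     (\<forall>v w. lin_indep2 v w \<longrightarrow>
        (\<exists>F \<in> insert (fst \<phi>) (range (snd \<phi>)). lin_indep2 (ev F v) (dev F v w)))"


subsection \<open>Smooth rational curves and intersection numbers\<close>

definition smooth_rational_curve :: "(9 \<Rightarrow> 'k::field ^ 2) \<Rightarrow> 'k blowup_point set \<Rightarrow> bool" where
  "smooth_rational_curve p E \<longleftrightarrow> E \<subseteq> blowup p \<and> (\<exists>\<phi>. closed_immersion \<phi> \<and> param_image \<phi> = E)"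

text \<open>An isomorphism from the projective line to \<open>E\<close>, unique up to automorphisms of the projective
  line and scaling of the forms; none of the numbers below depends on the choice.\<close>

definition parametrization :: "'k::field blowup_point set \<Rightarrow> 'k param" where
  "parametrization E = (SOME \<phi>. closed_immersion \<phi> \<and> param_image \<phi> = E)"

text \<open>The intersection number of a divisor with a smooth rational curve \<open>E\<close> is the degree of the
  pullback to \<open>E\<close> of the line bundle of the divisor. For \<open>L\<close> this bundle is \<open>\<pi>\<^sup>* O(1)\<close>.\<close>

definition dot_L :: "'k::field blowup_point set \<Rightarrow> int" where
  "dot_L E = int (fst (fst (parametrization E)))"

text \<open>The total transform of a line through \<open>p\<^sub>i\<close> is the sum of \<open>E\<^sub>i\<close> and a fibre of the map
  \<open>\<lambda>\<^sub>i\<close> to the pencil of lines through \<open>p\<^sub>i\<close>. Hence \<open>O(E\<^sub>i) = \<pi>\<^sup>* O(1) \<otimes> \<lambda>\<^sub>i\<^sup>* O(-1)\<close>. If \<open>f\<close> and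
  \<open>g\<close> are the forms giving \<open>\<pi>\<close> and \<open>\<lambda>\<^sub>i\<close> on \<open>E \<noteq> E\<^sub>i\<close>, then the cross product of \<open>p\<^sub>i\<close> and \<open>f\<close> is
  \<open>h g\<close>, where the form \<open>h\<close>, of degree \<open>deg f - deg g\<close>, cuts out the pullback of \<open>E\<^sub>i\<close>;
  the degree of \<open>h\<close> is the multiplicity of \<open>\<pi>(E)\<close> at \<open>p\<^sub>i\<close>. For \<open>E = E\<^sub>i\<close> the forms \<open>f\<close> are
  constant, the forms \<open>g\<close> are linear, and the number is \<open>-1\<close>.\<close>

definition dot_E :: "'k::field blowup_point set \<Rightarrow> 9 \<Rightarrow> int" where
  "dot_E E i = int (fst (fst (parametrization E))) - int (fst (snd (parametrization E) i))"

text \<open>The class \<open>t L - \<Sum> m\<^sub>i E\<^sub>i\<close> is represented by \<open>(t, m)\<close>. By \<open>L\<^sup>2 = 1\<close>, \<open>E\<^sub>i\<^sup>2 = -1\<close> the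
  coefficients \<open>t, m\<^sub>i\<close> of the class of \<open>E\<close> are the intersection numbers with \<open>L, E\<^sub>i\<close>.\<close>

definition intersection_form :: "int \<times> (9 \<Rightarrow> int) \<Rightarrow> int \<times> (9 \<Rightarrow> int) \<Rightarrow> int" where
  "intersection_form C D = fst C * fst D - (\<Sum>i\<in>UNIV. snd C i * snd D i)"

definition divisor_class :: "'k::field blowup_point set \<Rightarrow> int \<times> (9 \<Rightarrow> int)" where
  "divisor_class E = (dot_L E, dot_E E)"

definition exceptional_curve :: "(9 \<Rightarrow> 'k::field ^ 2) \<Rightarrow> 'k blowup_point set \<Rightarrow> bool" where
  "exceptional_curve p E \<longleftrightarrow>
     smooth_rational_curve p E \<and> intersection_form (divisor_class E) (divisor_class E) = -1"


subsection \<open>Splitting type\<close>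

text \<open>By the Euler sequence, \<open>\<Omega>(1)\<close> is the subbundle of the trivial bundle of dual vectors whose
  fibre at \<open>[x]\<close> is the annihilator of \<open>x\<close> (the dual of \<open>K\<^sup>3 / K x\<close>). A homomorphism from \<open>O(-a)\<close> on
  the projective line to the trivial bundle is a triple of forms of degree \<open>a\<close>. So an isomorphism
  from \<open>O(-a) \<oplus> O(-b)\<close> to the pullback of \<open>\<Omega>(1)\<close> under the morphism \<open>F\<close> is a pair of such triples
  whose values at each point \<open>[v]\<close> form a basis of the annihilator of \<open>F v\<close>.\<close>

definition pullback_Omega1_splits :: "'k::field forms \<Rightarrow> nat \<Rightarrow> nat \<Rightarrow> bool" where
  "pullback_Omega1_splits F a b \<longleftrightarrow>
     (\<exists>G H. is_forms G \<and> fst G = a \<and> is_forms H \<and> fst H = b \<and>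
        (\<forall>v. v \<noteq> 0 \<longrightarrow> pairing (ev G v) (ev F v) = 0 \<and> pairing (ev H v) (ev F v) = 0 \<and>
                        lin_indep2 (ev G v) (ev H v)))"

definition splitting_type :: "'k::field blowup_point set \<Rightarrow> nat \<times> nat" where
  "splitting_type D = (THE (a, b). a \<le> b \<and> int (a + b) = dot_L D \<and>
                         pullback_Omega1_splits (fst (parametrization D)) a b)"

definition split_a :: "'k::field blowup_point set \<Rightarrow> int" where
  "split_a D = int (fst (splitting_type D))"

definition split_b :: "'k::field blowup_point set \<Rightarrow> int" where
  "split_b D = int (snd (splitting_type D))"

definition splitting_gap :: "'k::field blowup_point set \<Rightarrow> int" where
  "splitting_gap D = split_b D - split_a D"

end

theory Submission
  imports Defs
begin

text \<open>Let \<open>d = 2 n + 2\<close> be the degree, \<open>m\<^sub>i = 2 k\<^sub>i + 1\<close> the multiplicities and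
  \<open>A = (E + K + L) / 2 = n L - \<Sum> k\<^sub>i E\<^sub>i\<close>. From \<open>E\<^sup>2 = -1\<close> alone, a parameter count gives a nonzero
  section of \<open>\<Omega>(1) \<otimes> O(A)\<close>, i.e. ternary forms \<open>g\<^sub>1, g\<^sub>2, g\<^sub>3\<close> of degree \<open>n\<close> with multiplicity
  \<open>k\<^sub>i\<close> at \<open>p\<^sub>i\<close> and \<open>x g\<^sub>1 + y g\<^sub>2 + z g\<^sub>3 = 0\<close>. As \<open>n < d\<close>, it does not vanish on \<open>E\<close>. Since
  \<open>A \<cdot> E \<le> n\<close>, its restriction to \<open>E\<close> is a nonzero syzygy of degree at most \<open>n\<close> on the forms
  parametrizing \<open>\<pi>(E)\<close>, whence \<open>a\<^sub>E \<le> n\<close>. Genericity is used only to have distinct points.\<close>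

subsection \<open>Polynomials and linear systems\<close>

text \<open>The parities make \<open>A\<close> integral: \<open>E + K + L\<close> is
  \<open>(d - 2) L - \<Sum> (m\<^sub>i - 1) E\<^sub>i\<close>. Riemann-Roch is replaced by a count.
  The forms \<open>g\<^sub>1\<close>, \<open>g\<^sub>2\<close> have \<open>(n + 1) * (n + 2)\<close>
  coefficients; divisibility of \<open>x g\<^sub>1 + y g\<^sub>2\<close> by \<open>z\<close> costs
  \<open>n + 2\<close> conditions, the point \<open>p\<^sub>i\<close> costs
  \<open>k\<^sub>i * (k\<^sub>i + 1)\<close>, and \<open>E\<^sup>2 = -1\<close> leaves a surplus of
  exactly one. Adjunction would give \<open>A \<cdot> E = n\<close>; here the bound
  \<open>K \<cdot> E \<le> 0\<close>, made strict by parity, gives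
  \<open>A \<cdot> E \<le> n\<close>. Two obstacles shape the details. Binary forms are stored
  dehomogenized, so a zero at \<open>(1 : 0)\<close> is invisible as a root: it shows as a gap
  between formal and actual degree and needs a separate argument each time. And the characteristic
  is arbitrary: multiplicities are expressed by Taylor coefficients with binomials instead of
  derivatives, and the lines that meet the curve in \<open>d\<close> distinct points must come from
  a centre of projection that is not ramified everywhere.\<close>

lemma coprime_polys_bezout:
  fixes a b c :: "'k::alg_closed_field poly"
  assumes "\<And>s. \<not> (poly a s = 0 \<and> poly b s = 0 \<and> poly c s = 0)"
  obtains x y z where "x * a + y * b + z * c = 1"
proof -
  \<comment> \<open>The ideal generated by \<open>a\<close>, \<open>b\<close>, \<open>c\<close>. A
    nonzero element \<open>u\<close> of least degree divides all three, hence has no root and is a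
    constant.\<close>
  define I where "I = {x * a + y * b + z * c | x y z. True}"
  have mem: "a \<in> I" "b \<in> I" "c \<in> I"
  proof -
    have "1 * a + 0 * b + 0 * c \<in> I" "0 * a + 1 * b + 0 * c \<in> I" "0 * a + 0 * b + 1 * c \<in> I"
      unfolding I_def by blast+
    then show "a \<in> I" "b \<in> I" "c \<in> I" by simp_all
  qed
  have mult: "w * u \<in> I" if "u \<in> I" for w u
  proof -
    from that obtain x y z where "u = x * a + y * b + z * c"
      unfolding I_def by blast
    then have "w * u = (w * x) * a + (w * y) * b + (w * z) * c"
      by (simp add: algebra_simps)
    then show ?thesis unfolding I_def by blast
  qed
  have diff: "u - v \<in> I" if "u \<in> I" "v \<in> I" for u v
  proof -
    from that obtain x y z x' y' z' where "u = x * a + y * b + z * c" "v = x' * a + y' * b + z' * c"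
      unfolding I_def by blast
    then have "u - v = (x - x') * a + (y - y') * b + (z - z') * c"
      by (simp add: algebra_simps)
    then show ?thesis unfolding I_def by blast
  qed
  have "\<exists>u. u \<in> I \<and> u \<noteq> 0"
    using assms[of 0] mem by (metis poly_0)
  then obtain u where u: "u \<in> I" "u \<noteq> 0" "\<And>v. v \<in> I \<Longrightarrow> v \<noteq> 0 \<Longrightarrow> degree u \<le> degree v"
    using ex_has_least_nat[of "\<lambda>u. u \<in> I \<and> u \<noteq> 0" _ degree] by blast
  have dvd: "u dvd v" if "v \<in> I" for v
  proof (rule ccontr)
    assume nd: "\<not> u dvd v"
    have "v mod u = v - (v div u) * u"
      by (simp add: minus_div_mult_eq_mod)
    then have "v mod u \<in> I" using diff mult u(1) that by simp
    moreover have "v mod u \<noteq> 0" using nd by (simp add: dvd_eq_mod_eq_0)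
    moreover from this have "degree (v mod u) < degree u"
      using degree_mod_less'[OF u(2)] by blast
    ultimately show False using u(3) by fastforce
  qed
  have "degree u = 0"
  proof (rule ccontr)
    assume "degree u \<noteq> 0"
    then obtain s where "poly u s = 0"
      using alg_closed_imp_poly_has_root[of u] by auto
    then show False using assms[of s] dvd[OF mem(1)] dvd[OF mem(2)] dvd[OF mem(3)]
      by (metis dvdE mult_zero_left poly_mult)
  qed
  then obtain k where k: "u = [:k:]" by (meson degree_eq_zeroE)
  with u(2) have "[:inverse k:] * u = 1" by (auto simp: one_pCons)
  with mult[OF u(1), of "[:inverse k:]"] have "1 \<in> I" by simp
  then show ?thesis unfolding I_def using that by (smt (verit) mem_Collect_eq)
qed

lemma coprime_polys_dvd_mult:
  fixes a b c :: "'k::alg_closed_field poly"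
  assumes cop: "\<And>s. \<not> (poly a s = 0 \<and> poly b s = 0)"
  shows "a dvd b * c \<Longrightarrow> a dvd c" and "a dvd c \<Longrightarrow> b dvd c \<Longrightarrow> a * b dvd c"
proof -
  obtain x y z where "x * a + y * b + z * 0 = 1"
    using coprime_polys_bezout[of a b 0] cop by auto
  then have xy: "x * a + y * b = 1" by simp
  have c: "c = a * (x * c) + y * (b * c)"
    using arg_cong[OF xy, of "\<lambda>w. w * c"] by (simp add: algebra_simps)
  show "a dvd c" if "a dvd b * c"
    using that c by (metis dvd_add dvd_mult dvd_triv_left)
  show "a * b dvd c" if ac: "a dvd c" and bc: "b dvd c"
  proof -
    from ac obtain k where k: "c = a * k" ..
    from bc obtain l where l: "c = b * l" ..
    have "c = x * a * c + y * b * c"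
      using xy by (metis mult_1 distrib_right)
    also have "\<dots> = x * a * (b * l) + y * b * (a * k)"
      using k l by simp
    also have "\<dots> = (a * b) * (x * l + y * k)" by (simp add: algebra_simps)
    finally show ?thesis by simp
  qed
qed

lemma prod_pairwise_coprime_polys_dvd:
  fixes h :: "'i \<Rightarrow> 'k::alg_closed_field poly"
  assumes "finite I" and "\<And>i. i \<in> I \<Longrightarrow> h i dvd c"
    and "\<And>i j s. i \<in> I \<Longrightarrow> j \<in> I \<Longrightarrow> i \<noteq> j \<Longrightarrow> \<not> (poly (h i) s = 0 \<and> poly (h j) s = 0)"
  shows "(\<Prod>i\<in>I. h i) dvd c"
  using assms
proof (induction I rule: finite_induct)
  case (insert i I)
  have "\<not> (poly (h i) s = 0 \<and> poly (\<Prod>i\<in>I. h i) s = 0)" for s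
    using insert by (auto simp: poly_prod prod_zero_iff)
  then have "h i * (\<Prod>i\<in>I. h i) dvd c"
    using insert by (intro coprime_polys_dvd_mult(2)) auto
  then show ?case using insert by simp
qed simp

text \<open>Euclid's argument: one plus the product of all \<open>X - a\<close> has positive degree
  but no root.\<close>

lemma infinite_UNIV_alg_closed: "infinite (UNIV :: 'k::alg_closed_field set)"
proof
  assume fin: "finite (UNIV :: 'k set)"
  define q :: "'k poly" where "q = (\<Prod>a\<in>UNIV. [:- a, 1:]) + 1"
  have "degree (\<Prod>a\<in>(UNIV::'k set). [:- a, 1:]) = card (UNIV :: 'k set)"
    by (subst degree_prod_eq_sum_degree) auto
  moreover have "card (UNIV :: 'k set) > 0" using fin by (simp add: card_gt_0_iff)
  ultimately have "degree q > 0" unfolding q_def by (subst degree_add_eq_left) auto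
  then obtain s where "poly q s = 0" using alg_closed_imp_poly_has_root by blast
  moreover have "(\<Prod>a\<in>(UNIV::'k set). poly [:- a, 1:] s) = 0"
    using fin by (intro prod_zero) auto
  ultimately show False by (simp add: q_def poly_prod)
qed

text \<open>A simple root \<open>a\<close> is not a root of the quotient by \<open>X - a\<close>, so
  each linear factor contributes a new root. This counts the points in which a line meets the
  curve.\<close>

lemma card_roots_simple:
  fixes q :: "'k::alg_closed_field poly"
  assumes "q \<noteq> 0" and "\<And>s. poly q s = 0 \<Longrightarrow> poly (pderiv q) s \<noteq> 0"
  shows "card {s. poly q s = 0} = degree q"
  using assms
proof (induction "degree q" arbitrary: q)
  case 0
  then obtain k where "q = [:k:]" using degree_eq_zeroE by metis
  then show ?case using 0 by auto
next
  case (Suc n)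
  then obtain a where a: "poly q a = 0" using alg_closed_imp_poly_has_root[of q] by auto
  then obtain r where r: "q = [:- a, 1:] * r" using poly_eq_0_iff_dvd by (metis dvdE)
  have r0: "r \<noteq> 0" using Suc.prems r by auto
  have deg: "degree q = Suc (degree r)" using r r0 by (simp add: degree_mult_eq del: mult_pCons_left)
  have pd: "pderiv q = r + [:- a, 1:] * pderiv r"
    unfolding r by (simp only: pderiv_mult pderiv_pCons) simp
  have ra: "poly r a \<noteq> 0" using Suc.prems(2)[OF a] pd by simp
  have "poly (pderiv r) s \<noteq> 0" if s: "poly r s = 0" for s
    using Suc.prems(2)[of s] pd r s by auto
  then have "card {s. poly r s = 0} = degree r"
    using Suc.hyps(1)[of r] r0 deg Suc.hyps(2) by simp
  moreover have "{s. poly q s = 0} = insert a {s. poly r s = 0}"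
    unfolding r by auto
  ultimately show ?case using ra deg poly_roots_finite[OF r0] by simp
qed

lemma underdetermined_system:
  fixes A :: "'j \<Rightarrow> 'i \<Rightarrow> 'k::field"
  assumes "finite J" "finite I" "card J < card I"
  shows "\<exists>x. (\<exists>i\<in>I. x i \<noteq> 0) \<and> (\<forall>j\<in>J. (\<Sum>i\<in>I. A j i * x i) = 0)"
  using assms
proof (induction J arbitrary: I A rule: finite_induct)
  case empty
  then have "I \<noteq> {}" by auto
  then show ?case by (intro exI[of _ "\<lambda>_. 1"]) auto
next
  case (insert j0 J)
  show ?case
  proof (cases "\<forall>i\<in>I. A j0 i = 0")
    case True
    have "card J < card I" using insert by simp
    then obtain x where "\<exists>i\<in>I. x i \<noteq> 0" "\<forall>j\<in>J. (\<Sum>i\<in>I. A j i * x i) = 0"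
      using insert.IH[of I A] insert.prems by blast
    with True show ?thesis by (intro exI[of _ x]) auto
  next
    case False
    then obtain i0 where i0: "i0 \<in> I" "A j0 i0 \<noteq> 0" by blast
    \<comment> \<open>Elimination of the unknown \<open>i0\<close> by the equation
      \<open>j0\<close>; the constant \<open>c\<close> below recovers that unknown by back
      substitution.\<close>
    define B where "B j i = A j i - A j i0 * A j0 i / A j0 i0" for j i
    have "card J < card (I - {i0})" using insert i0 by simp
    then obtain x where x: "\<exists>i\<in>I-{i0}. x i \<noteq> 0" "\<forall>j\<in>J. (\<Sum>i\<in>I-{i0}. B j i * x i) = 0"
      using insert.IH[of "I - {i0}" B] insert.prems by blast
    define c where "c = - (\<Sum>i\<in>I-{i0}. A j0 i * x i) / A j0 i0"
    define y where "y = x(i0 := c)"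
    have y: "(\<Sum>i\<in>I. A j i * y i) = A j i0 * c + (\<Sum>i\<in>I-{i0}. A j i * x i)" for j
      using i0 insert.prems by (subst sum.remove[of _ i0]) (auto simp: y_def intro!: sum.cong)
    have "(\<Sum>i\<in>I. A j i * y i) = 0" if "j \<in> J" for j
    proof -
      have "0 = (\<Sum>i\<in>I-{i0}. A j i * x i - A j i0 / A j0 i0 * (A j0 i * x i))"
        using x(2) that by (auto simp: B_def algebra_simps)
      also have "\<dots> = (\<Sum>i\<in>I-{i0}. A j i * x i) - A j i0 / A j0 i0 * (\<Sum>i\<in>I-{i0}. A j0 i * x i)"
        by (simp only: sum_subtractf sum_distrib_left)
      also have "\<dots> = (\<Sum>i\<in>I. A j i * y i)" by (simp add: y c_def)
      finally show ?thesis by simp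
    qed
    moreover have "(\<Sum>i\<in>I. A j0 i * y i) = 0" using i0 by (simp add: y c_def)
    moreover have "\<exists>i\<in>I. y i \<noteq> 0" using x(1) by (auto simp: y_def)
    ultimately show ?thesis by (intro exI[of _ y]) auto
  qed
qed

subsection \<open>Triples of binary forms\<close>

definition cross :: "'a::comm_ring_1 ^ 3 \<Rightarrow> 'a ^ 3 \<Rightarrow> 'a ^ 3" where
  "cross x y = vector [x$2 * y$3 - x$3 * y$2, x$3 * y$1 - x$1 * y$3, x$1 * y$2 - x$2 * y$1]"

definition dotp :: "'a::comm_ring_1 ^ 3 \<Rightarrow> 'a ^ 3 \<Rightarrow> 'a" where
  "dotp x y = x$1 * y$1 + x$2 * y$2 + x$3 * y$3"

lemma cross_nth [simp]:
  "cross x y $ 1 = x$2 * y$3 - x$3 * y$2"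
  "cross x y $ 2 = x$3 * y$1 - x$1 * y$3"
  "cross x y $ 3 = x$1 * y$2 - x$2 * y$1"
  by (simp_all add: cross_def)

lemma vec3_eq_iff: "x = y \<longleftrightarrow> x$1 = y$1 \<and> x$2 = y$2 \<and> x$3 = y$3" for x y :: "'a ^ 3"
  by (simp add: vec_eq_iff forall_3)

lemma pairing_eq_dotp: "pairing x y = dotp x y"
  by (simp add: pairing_def dotp_def sum_3)

lemma cross_eq_0_imp_parallel:
  fixes x y :: "'k::field ^ 3"
  assumes "cross x y = 0" "y \<noteq> 0"
  obtains c where "x = c *s y"
proof -
  have e: "x$2 * y$3 = x$3 * y$2" "x$3 * y$1 = x$1 * y$3" "x$1 * y$2 = x$2 * y$1"
    using assms(1) by (simp_all add: vec3_eq_iff)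
  consider "y$1 \<noteq> 0" | "y$2 \<noteq> 0" | "y$3 \<noteq> 0" using assms(2) by (auto simp: vec3_eq_iff)
  then show ?thesis
  proof cases
    case 1
    then have "x = (x$1 / y$1) *s y" using e by (auto simp: vec3_eq_iff field_simps)
    then show ?thesis using that by blast
  next
    case 2
    then have "x = (x$2 / y$2) *s y" using e by (auto simp: vec3_eq_iff field_simps)
    then show ?thesis using that by blast
  next
    case 3
    then have "x = (x$3 / y$3) *s y" using e by (auto simp: vec3_eq_iff field_simps)
    then show ?thesis using that by blast
  qed
qed

lemma cross_smult [simp]: "cross (c *s y) y = 0" "cross y (c *s y) = 0"
  by (auto simp: vec3_eq_iff algebra_simps)

lemma lin_indep2_iff_cross: "lin_indep2 x y \<longleftrightarrow> cross x y \<noteq> 0" for x y :: "'k::field ^ 3"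
proof
  assume l: "lin_indep2 x y"
  then have y: "y \<noteq> 0" unfolding lin_indep2_def
    by (metis add.right_neutral vector_smult_lzero vector_smult_rzero zero_neq_one)
  show "cross x y \<noteq> 0"
  proof
    assume "cross x y = 0"
    then obtain c where c: "x = c *s y" using cross_eq_0_imp_parallel y by blast
    have "1 *s x + (- c) *s y = 0" unfolding c by (simp add: vec3_eq_iff)
    then show False using l unfolding lin_indep2_def by (metis zero_neq_one)
  qed
next
  assume c: "cross x y \<noteq> 0"
  show "lin_indep2 x y"
    unfolding lin_indep2_def
  proof (intro allI impI)
    fix a b assume "a *s x + b *s y = 0"
    then have e: "a * x$j + b * y$j = 0" for j by (metis vector_add_component vector_smult_component zero_index)
    have "a * (x$i * y$j - x$j * y$i) = y$j * (a * x$i + b * y$i) - y$i * (a * x$j + b * y$j)"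
      "b * (x$i * y$j - x$j * y$i) = x$i * (a * x$j + b * y$j) - x$j * (a * x$i + b * y$i)" for i j
      by (simp_all add: algebra_simps)
    then have "a * (x$i * y$j - x$j * y$i) = 0" "b * (x$i * y$j - x$j * y$i) = 0" for i j
      using e by simp_all
    moreover obtain i j where "x$i * y$j - x$j * y$i \<noteq> 0" using c by (auto simp: vec3_eq_iff)
    ultimately show "a = 0 \<and> b = 0" by (metis mult_eq_0_iff)
  qed
qed

text \<open>By the triple product expansion, both \<open>g\<close> and \<open>h\<close> are
  multiples of \<open>cross f q\<close>. Geometrically, two distinct points lie on only one line, so
  away from \<open>p\<^sub>i\<close> the map \<open>\<lambda>\<^sub>i\<close> is determined by
  \<open>\<pi>\<close>.\<close>

lemma orthogonal_complement_dim1: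
  fixes f q g h :: "'k::field ^ 3"
  assumes "cross f q \<noteq> 0" "dotp g f = 0" "dotp g q = 0" "dotp h f = 0" "dotp h q = 0" "h \<noteq> 0"
  obtains c where "g = c *s h"
proof -
  have 1: "cross x (cross f q) = 0" if "dotp x f = 0" "dotp x q = 0" for x
  proof -
    have "cross x (cross f q) = (dotp x q) *s f - (dotp x f) *s q"
      by (simp add: vec3_eq_iff dotp_def algebra_simps)
    then show ?thesis using that by simp
  qed
  obtain a where a: "g = a *s cross f q" using cross_eq_0_imp_parallel[OF 1 assms(1)] assms by blast
  obtain b where b: "h = b *s cross f q" using cross_eq_0_imp_parallel[OF 1 assms(1)] assms by blast
  have "b \<noteq> 0" using b assms(6) by auto
  then have "g = (a / b) *s h" using a b by (simp add: vector_smult_assoc)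
  then show ?thesis using that by blast
qed

lemma span_singleton_eq:
  fixes x y :: "'k::field ^ 'n"
  assumes "vec.span {x} = vec.span {y}" "y \<noteq> 0"
  obtains c where "c \<noteq> 0" "y = c *s x"
proof -
  have "y \<in> vec.span {x}" using assms by (simp add: vec.span_base)
  then obtain c where "y = c *s x" by (auto simp: vec.span_singleton)
  moreover from this have "c \<noteq> 0" using assms(2) by auto
  ultimately show ?thesis using that by blast
qed

lemma span_singleton_smult:
  fixes x :: "'k::field ^ 'n"
  assumes "c \<noteq> 0"
  shows "vec.span {c *s x} = vec.span {x}"
proof -
  have "k *s x = (k / c) *s (c *s x)" for k using assms by (simp add: vector_smult_assoc)
  moreover have "k *s (c *s x) = (k * c) *s x" for k by (simp add: vector_smult_assoc)
  ultimately show ?thesis unfolding vec.span_singleton by (metis (no_types, lifting) image_cong rangeE rangeI subset_antisym subsetI)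
qed

section \<open>Polynomial triples as forms on the projective line: values at \<open>(s : 1)\<close>
  and at \<open>(1 : 0)\<close>\<close>

definition pev :: "'k::field poly ^ 3 \<Rightarrow> 'k \<Rightarrow> 'k ^ 3" where
  "pev F s = (\<chi> i. poly (F $ i) s)"

text \<open>The value at \<open>(1 : 0)\<close> of a triple of binary forms of degree \<open>N\<close>.\<close>

definition topc :: "nat \<Rightarrow> 'k::field poly ^ 3 \<Rightarrow> 'k ^ 3" where
  "topc N F = (\<chi> i. coeff (F $ i) N)"

definition degle :: "nat \<Rightarrow> 'k::field poly ^ 3 \<Rightarrow> bool" where
  "degle N F \<longleftrightarrow> (\<forall>i. degree (F $ i) \<le> N)"

text \<open>No common zero on the whole projective line; the last conjunct takes care of the point
  \<open>(1 : 0)\<close>.\<close>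

definition base_point_free :: "nat \<Rightarrow> 'k::field poly ^ 3 \<Rightarrow> bool" where
  "base_point_free N F \<longleftrightarrow> degle N F \<and> (\<forall>s. pev F s \<noteq> 0) \<and> topc N F \<noteq> 0"

lemma pev_nth [simp]: "pev F s $ i = poly (F $ i) s" by (simp add: pev_def)
lemma topc_nth [simp]: "topc N F $ i = coeff (F $ i) N" by (simp add: topc_def)

lemma is_forms_iff_degle: "is_forms F \<longleftrightarrow> degle (fst F) (snd F)"
  by (simp add: is_forms_def degle_def)

lemma poly_sum_le: "degree (p :: 'a::comm_semiring_1 poly) \<le> N \<Longrightarrow> poly p x = (\<Sum>j\<le>N. coeff p j * x ^ j)"
  unfolding poly_altdef by (rule sum.mono_neutral_left) (auto simp: coeff_eq_0)

text \<open>This is what makes \<open>topc\<close> behave like an evaluation: relative to the formal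
  degrees \<open>m\<close> and \<open>n\<close> the top coefficient is multiplicative, whether or
  not it vanishes.\<close>

lemma coeff_mult_top:
  assumes "degree p \<le> m" "degree q \<le> n"
  shows "coeff (p * q) (m + n) = coeff p m * coeff q n"
proof -
  have "coeff (p * q) (m + n) = (\<Sum>i\<le>m+n. coeff p i * coeff q (m + n - i))"
    by (simp add: coeff_mult)
  also have "\<dots> = (\<Sum>i\<in>{m}. coeff p i * coeff q (m + n - i))"
  proof (rule sum.mono_neutral_right)
    show "\<forall>i\<in>{..m + n} - {m}. coeff p i * coeff q (m + n - i) = 0"
    proof
      fix i assume "i \<in> {..m + n} - {m}"
      then consider "i > m" | "m + n - i > n" by force
      then show "coeff p i * coeff q (m + n - i) = 0"
        using assms by cases (auto simp: coeff_eq_0)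
    qed
  qed auto
  finally show ?thesis by simp
qed

lemma ev_affine:
  assumes "is_forms F" "v$2 \<noteq> 0"
  shows "ev F v = (v$2 ^ fst F) *s pev (snd F) (v$1 / v$2)"
proof -
  have "(\<Sum>j\<le>N. coeff p j * (a ^ j * b ^ (N - j))) = b ^ N * poly p (a / b)"
    if "degree p \<le> N" "b \<noteq> 0" for p :: "'a poly" and N a b
    unfolding poly_sum_le[OF that(1)] sum_distrib_left
    using that(2) by (intro sum.cong) (auto simp: field_simps power_diff)
  then show ?thesis using assms by (simp add: ev_def vec_eq_iff is_forms_def)
qed

lemma ev_infinity:
  assumes "v$2 = 0"
  shows "ev F v = (v$1 ^ fst F) *s topc (fst F) (snd F)"
proof -
  have "(\<Sum>j\<le>N. c j * (a ^ j * 0 ^ (N - j))) = c N * a ^ N" for c :: "nat \<Rightarrow> 'a" and N a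
  proof -
    have "(\<Sum>j\<le>N. c j * (a ^ j * 0 ^ (N - j))) = (\<Sum>j\<in>{N}. c j * (a ^ j * 0 ^ (N - j)))"
      by (rule sum.mono_neutral_right) auto
    then show ?thesis by simp
  qed
  then show ?thesis using assms by (simp add: ev_def vec_eq_iff mult.commute)
qed

lemma ev_affine_vector: "is_forms F \<Longrightarrow> ev F (vector [s, 1]) = pev (snd F) s"
  by (simp add: ev_affine)

lemma ev_infinity_vector: "ev F (vector [1, 0]) = topc (fst F) (snd F)"
  by (simp add: ev_infinity)

lemma vec2_nonzero: "vector [s, 1 :: 'k::field] \<noteq> (0 :: 'k ^ 2)" "vector [1 :: 'k, 0] \<noteq> (0 :: 'k ^ 2)"
  by (auto simp: vec_eq_iff forall_2)

lemma is_morphism_iff: "is_morphism F \<longleftrightarrow> base_point_free (fst F) (snd F)"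
proof
  assume "is_morphism F"
  then show "base_point_free (fst F) (snd F)"
    unfolding is_morphism_def base_point_free_def is_forms_iff_degle[symmetric]
    using ev_affine_vector[of F] ev_infinity_vector[of F] vec2_nonzero by metis
next
  assume b: "base_point_free (fst F) (snd F)"
  then have f: "is_forms F" by (simp add: base_point_free_def is_forms_iff_degle)
  have "ev F v \<noteq> 0" if "v \<noteq> 0" for v
  proof (cases "v$2 = 0")
    case True
    then have "v$1 \<noteq> 0" using that by (auto simp: vec_eq_iff forall_2)
    then show ?thesis using b True by (simp add: ev_infinity base_point_free_def)
  next
    case False
    then show ?thesis using b f by (simp add: ev_affine base_point_free_def)
  qed
  with f show "is_morphism F" by (simp add: is_morphism_def)
qed

lemma pev_cross: "pev (cross F G) s = cross (pev F s) (pev G s)"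
  by (simp add: vec3_eq_iff)

lemma pev_dotp: "poly (dotp F G) s = dotp (pev F s) (pev G s)"
  by (simp add: dotp_def)

lemma topc_cross: "degle M F \<Longrightarrow> degle N G \<Longrightarrow> topc (M + N) (cross F G) = cross (topc M F) (topc N G)"
  by (simp add: vec3_eq_iff degle_def coeff_mult_top)

lemma topc_dotp: "degle M F \<Longrightarrow> degle N G \<Longrightarrow> coeff (dotp F G) (M + N) = dotp (topc M F) (topc N G)"
  by (simp add: dotp_def degle_def coeff_mult_top)

lemma degle_cross: "degle M F \<Longrightarrow> degle N G \<Longrightarrow> degle (M + N) (cross F G)"
  unfolding degle_def forall_3 cross_nth
  by (intro conjI degree_diff_le) (meson add_mono degree_mult_le le_trans)+

lemma poly_eq_0_if_all_roots:
  fixes p :: "'k::alg_closed_field poly"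
  assumes "\<And>s. poly p s = 0"
  shows "p = 0"
  using poly_roots_finite[of p] assms infinite_UNIV_alg_closed[where 'k='k] by auto

lemma pev_eq_0_imp: "(\<And>s. pev F s = 0) \<Longrightarrow> F = 0" for F :: "'k::alg_closed_field poly ^ 3"
  by (simp add: vec_eq_iff poly_eq_0_if_all_roots)

text \<open>Proportionality alone gives a rational function as factor. Combining the components of
  \<open>Q\<close> with the Bezout coefficients of those of \<open>G\<close> makes it a
  polynomial.\<close>

lemma cross_eq_0_factor:
  fixes Q G :: "'k::alg_closed_field poly ^ 3"
  assumes "cross Q G = 0" "\<And>s. pev G s \<noteq> 0"
  obtains h where "Q = h *s G"
proof -
  have e: "Q$2 * G$3 = Q$3 * G$2" "Q$3 * G$1 = Q$1 * G$3" "Q$1 * G$2 = Q$2 * G$1"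
    using assms(1) by (simp_all add: vec3_eq_iff)
  have "\<not> (poly (G$1) s = 0 \<and> poly (G$2) s = 0 \<and> poly (G$3) s = 0)" for s
    using assms(2)[of s] by (simp add: vec3_eq_iff)
  then obtain x y z where xyz: "x * G$1 + y * G$2 + z * G$3 = 1"
    using coprime_polys_bezout by metis
  define h where "h = x * Q$1 + y * Q$2 + z * Q$3"
  have h: "h * G$i = (x * G$1 + y * G$2 + z * G$3) * Q$i" if "\<And>j. Q$j * G$i = Q$i * G$j" for i
  proof -
    have "h * G$i = x * (Q$1 * G$i) + y * (Q$2 * G$i) + z * (Q$3 * G$i)"
      by (simp add: h_def algebra_simps)
    also have "\<dots> = (x * G$1 + y * G$2 + z * G$3) * Q$i"
      unfolding that by (simp add: algebra_simps)
    finally show ?thesis .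
  qed
  have "Q$j * G$i = Q$i * G$j" for i j
    using exhaust_3[of i] exhaust_3[of j] e by auto
  then have "h * G$i = Q$i" for i using h[of i] xyz by simp
  then have "Q = h *s G" by (simp add: vec_eq_iff)
  then show ?thesis using that by blast
qed

text \<open>Since \<open>G\<close> does not vanish at \<open>(1 : 0)\<close>, one of its components
  has degree exactly \<open>e\<close>, and the degrees of the factors add up there.\<close>

lemma degree_factor_le:
  fixes h :: "'k::field poly"
  assumes "degle e G" "topc e G \<noteq> 0" "degle N (h *s G)" "h \<noteq> 0"
  shows "degree h + e \<le> N"
proof -
  obtain i where i: "coeff (G$i) e \<noteq> 0" using assms(2) by (auto simp: vec_eq_iff)
  then have "degree (G$i) = e" using assms(1) le_degree unfolding degle_def by (metis le_antisym)
  moreover from i have "G$i \<noteq> 0" by auto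
  ultimately have "degree (h * G$i) = degree h + e" using assms(4) by (simp add: degree_mult_eq)
  then show ?thesis using assms(3) unfolding degle_def by (metis vector_smult_component)
qed

subsection \<open>Syzygies and the splitting type\<close>

text \<open>A homomorphism from \<open>O(-e)\<close> to the pullback of \<open>\<Omega>(1)\<close>,
  by the Euler sequence.\<close>

definition syzygy :: "'k::field poly ^ 3 \<Rightarrow> nat \<Rightarrow> 'k poly ^ 3 \<Rightarrow> bool" where
  "syzygy f e G \<longleftrightarrow> degle e G \<and> dotp G f = 0"

text \<open>Dividing out a zero: at a point \<open>(s : 1)\<close> by a linear factor, at \<open>(1 : 0)\<close> by dropping the
  vanishing leading coefficients.\<close>

lemma syzygy_divide_root:
  fixes f G :: "'k::field poly ^ 3"
  assumes "syzygy f e G" "G \<noteq> 0" "pev G s = 0"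
  obtains G' where "syzygy f (e - 1) G'" "G = [:- s, 1:] *s G'" "e > 0"
proof -
  define G' where "G' = (\<chi> i. G$i div [:- s, 1:])"
  have "[:- s, 1:] dvd G$i" for i
    using assms(3) by (simp add: vec_eq_iff poly_eq_0_iff_dvd)
  then have G: "G = [:- s, 1:] *s G'"
    by (simp add: G'_def vec_eq_iff del: mult_pCons_left)
  then have "[:- s, 1:] * dotp G' f = dotp G f"
    by (simp add: dotp_def algebra_simps del: mult_pCons_left mult_pCons_right)
  then have 1: "dotp G' f = 0" using assms(1) by (simp add: syzygy_def del: mult_pCons_left)
  have deg: "degree (G$i) = Suc (degree (G'$i))" if "G'$i \<noteq> 0" for i
    using that G by (simp add: vec_eq_iff degree_mult_eq del: mult_pCons_left)
  have "degle (e - 1) G'" unfolding degle_def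
  proof
    fix i show "degree (G'$i) \<le> e - 1"
      using assms(1) deg[of i] unfolding syzygy_def degle_def
      by (cases "G'$i = 0") (auto dest: spec[of _ i])
  qed
  moreover have "e > 0"
  proof -
    from G assms(2) have "G' \<noteq> 0" by auto
    then obtain i where "G'$i \<noteq> 0" by (auto simp: vec_eq_iff)
    with deg[of i] show ?thesis using assms(1) unfolding syzygy_def degle_def
      by (metis gr0I le_zero_eq nat.distinct(1))
  qed
  ultimately show ?thesis using that 1 G by (simp add: syzygy_def)
qed

lemma syzygy_divide_infinity:
  fixes f G :: "'k::field poly ^ 3"
  assumes "syzygy f e G" "G \<noteq> 0" "topc e G = 0"
  shows "syzygy f (e - 1) G \<and> e > 0"
proof -
  have c: "coeff (G$i) e = 0" for i using assms(3) by (simp add: vec_eq_iff)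
  have le: "degree (G$i) \<le> e" for i using assms(1) by (simp add: syzygy_def degle_def)
  have "e > 0"
  proof (rule ccontr)
    assume "\<not> e > 0"
    then have "G$i = 0" for i using c[of i] le[of i] by (metis gr0I leading_coeff_0_iff le_zero_eq)
    then show False using assms(2) by (simp add: vec_eq_iff)
  qed
  moreover have "degree (G$i) \<le> e - 1" for i
  proof (cases "G$i = 0")
    case False
    then have "degree (G$i) \<noteq> e" using c[of i] by auto
    then show ?thesis using le[of i] by simp
  qed simp
  ultimately show ?thesis using assms(1) by (simp add: syzygy_def degle_def)
qed

text \<open>An isomorphism from \<open>O(-a) \<oplus> O(-b)\<close> to the pullback of
  \<open>\<Omega>(1)\<close>: two syzygies that are independent in every fibre, including the one
  over \<open>(1 : 0)\<close>.\<close>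

definition splitting_basis :: "'k::field poly ^ 3 \<Rightarrow> nat \<Rightarrow> nat \<Rightarrow> 'k poly ^ 3 \<Rightarrow> 'k poly ^ 3 \<Rightarrow> bool" where
  "splitting_basis f a b G H \<longleftrightarrow> syzygy f a G \<and> syzygy f b H \<and>
     (\<forall>s. cross (pev G s) (pev H s) \<noteq> 0) \<and> cross (topc a G) (topc b H) \<noteq> 0"

text \<open>\<open>G\<close> is a nonzero syzygy of least degree, \<open>H\<close> one of least degree among those that are not
  multiples of \<open>G\<close>. Where \<open>G\<close> and \<open>H\<close> are dependent, a combination of them
  could be divided by a linear form.\<close>

lemma ex_splitting_basis:
  fixes f :: "'k::alg_closed_field poly ^ 3"
  assumes bpf: "base_point_free d f"
  obtains a b G H where "a \<le> b" "a + b = d" "splitting_basis f a b G H"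
proof -
  have f_deg: "degle d f" and f_ev: "\<And>s. pev f s \<noteq> 0" and f_top: "topc d f \<noteq> 0"
    using bpf by (auto simp: base_point_free_def)
  \<comment> \<open>The Koszul syzygies. They have degree \<open>d\<close> and are not all multiples
    of one triple, which makes both minima below exist.\<close>
  define K :: "3 \<Rightarrow> 'k poly ^ 3" where
    "K = (\<lambda>j. cross f (axis j 1))"
  have K: "syzygy f d (K j)" for j
  proof -
    have "degle 0 (axis j 1 :: 'k poly ^ 3)" by (auto simp: degle_def axis_def)
    then have "degle d (K j)" unfolding K_def using degle_cross[OF f_deg] by fastforce
    moreover have "dotp (K j) f = 0" by (simp add: dotp_def K_def algebra_simps)
    ultimately show ?thesis by (simp add: syzygy_def)
  qed
  have f_nz: "f \<noteq> 0" using f_ev[of 0] by (metis pev_nth poly_0 vec_eq_iff zero_index)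
  have K_indep: "\<exists>j. \<not> (\<exists>u. K j = u *s G)" for G
  proof (rule ccontr)
    assume "\<not> ?thesis"
    then have "\<forall>j. \<exists>u. K j = u *s G" by blast
    then obtain u where "\<And>j. K j = u j *s G" by metis
    then have u: "K j $ i = u j * G $ i" for i j by simp
    have vals: "K 1 $ 1 = 0" "K 1 $ 2 = f$3" "K 1 $ 3 = - f$2"
      "K 2 $ 1 = - f$3" "K 2 $ 2 = 0" "K 2 $ 3 = f$1"
      "K 3 $ 1 = f$2" "K 3 $ 2 = - f$1" "K 3 $ 3 = 0"
      by (simp_all add: K_def axis_def)
    have "f$1 = 0" "f$2 = 0" "f$3 = 0"
      using u vals by (metis mult_eq_0_iff neg_equal_0_iff_equal)+
    then show False using f_nz by (simp add: vec3_eq_iff)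
  qed
  have "\<exists>G. syzygy f d G \<and> G \<noteq> 0"
    using K_indep[of 0] K by (metis vector_smult_lzero)
  define a where "a = (LEAST e. \<exists>G. syzygy f e G \<and> G \<noteq> 0)"
  have "\<exists>G. syzygy f a G \<and> G \<noteq> 0"
    unfolding a_def by (rule LeastI) fact
  then obtain G where G: "syzygy f a G" "G \<noteq> 0" by blast
  have a_min: "a \<le> e" if "syzygy f e G'" "G' \<noteq> 0" for e G'
    unfolding a_def using that by (intro Least_le) blast
  have G_ev: "pev G s \<noteq> 0" for s
  proof
    assume "pev G s = 0"
    then obtain G' where "syzygy f (a - 1) G'" "G = [:- s, 1:] *s G'" "a > 0"
      using syzygy_divide_root[OF G] by blast
    moreover from this G(2) have "G' \<noteq> 0" by auto
    ultimately show False using a_min[of "a - 1" G'] by simp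
  qed
  have G_top: "topc a G \<noteq> 0"
    using syzygy_divide_infinity[OF G] a_min[of "a - 1" G] G(2) by auto
  define b where "b = (LEAST e. \<exists>H. syzygy f e H \<and> \<not> (\<exists>u. H = u *s G))"
  have "\<exists>H. syzygy f b H \<and> \<not> (\<exists>u. H = u *s G)"
    unfolding b_def by (rule LeastI[of _ d]) (use K K_indep[of G] in blast)
  then obtain H where H: "syzygy f b H" "\<not> (\<exists>u. H = u *s G)" by blast
  have b_min: "b \<le> e" if "syzygy f e H'" "\<not> (\<exists>u. H' = u *s G)" for e H'
    unfolding b_def using that by (intro Least_le) blast
  have H_nz: "H \<noteq> 0" using H(2) by (metis vector_smult_lzero)
  then have ab: "a \<le> b" using a_min H(1) by blast
  have combo: "syzygy f b (H - u *s G) \<and> \<not> (\<exists>v. H - u *s G = v *s G) \<and> H - u *s G \<noteq> 0"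
    if "degree u + a \<le> b" for u
  proof -
    have "degree (u * G$i) \<le> b" for i
      using that G(1) degree_mult_le[of u "G$i"] unfolding syzygy_def degle_def
      by (meson add_left_mono le_trans)
    then have "degle b (H - u *s G)"
      using H(1) by (auto simp: degle_def syzygy_def intro: degree_diff_le)
    moreover have "dotp (H - u *s G) f = dotp H f - u * dotp G f"
      by (simp add: dotp_def algebra_simps)
    moreover have nm: "\<not> (\<exists>v. H - u *s G = v *s G)"
    proof
      assume "\<exists>v. H - u *s G = v *s G"
      then obtain v where "H - u *s G = v *s G" ..
      then have "H = (v + u) *s G" by (metis diff_add_cancel vector_sadd_rdistrib)
      then show False using H(2) by blast
    qed
    moreover have "H - u *s G \<noteq> 0" using nm by (metis vector_smult_lzero)
    ultimately show ?thesis using G(1) H(1) by (simp add: syzygy_def)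
  qed
  have ev_indep: "cross (pev G s) (pev H s) \<noteq> 0" for s
  proof
    assume "cross (pev G s) (pev H s) = 0"
    then have "cross (pev H s) (pev G s) = 0" by (simp add: vec3_eq_iff algebra_simps)
    then obtain c where c: "pev H s = c *s pev G s"
      using cross_eq_0_imp_parallel G_ev by blast
    define H1 where "H1 = H - [:c:] *s G"
    have H1: "syzygy f b H1" "\<not> (\<exists>v. H1 = v *s G)" "H1 \<noteq> 0"
      using combo[of "[:c:]"] ab unfolding H1_def by auto
    have "pev H1 s = 0" using c by (simp add: H1_def vec_eq_iff)
    then obtain H2 where H2: "syzygy f (b - 1) H2" "H1 = [:- s, 1:] *s H2" "b > 0"
      using syzygy_divide_root[OF H1(1,3)] by blast
    have "\<not> (\<exists>v. H2 = v *s G)"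
      using H1(2) H2(2) by (metis vector_smult_assoc)
    then show False using b_min[OF H2(1)] H2(3) by simp
  qed
  have top_indep: "cross (topc a G) (topc b H) \<noteq> 0"
  proof
    assume "cross (topc a G) (topc b H) = 0"
    then have "cross (topc b H) (topc a G) = 0" by (simp add: vec3_eq_iff algebra_simps)
    then obtain c where c: "topc b H = c *s topc a G"
      using cross_eq_0_imp_parallel G_top by blast
    \<comment> \<open>Homogeneously, \<open>c * s ^ (b - a)\<close>: it lifts \<open>G\<close> to
      degree \<open>b\<close> and cancels the value of \<open>H\<close> at
      \<open>(1 : 0)\<close>.\<close>
    define u where "u = monom c (b - a)"
    define H1 where "H1 = H - u *s G"
    have H1: "syzygy f b H1" "\<not> (\<exists>v. H1 = v *s G)" "H1 \<noteq> 0"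
      using combo[of u] ab degree_monom_le[of c "b - a"] unfolding H1_def u_def by auto
    have "coeff (u * G$i) b = c * coeff (G$i) a" for i
      using ab by (simp add: u_def coeff_monom_mult)
    then have "topc b H1 = 0" using c by (simp add: H1_def vec_eq_iff)
    then show False
      using syzygy_divide_infinity[OF H1(1,3)] b_min[of "b - 1" H1] H1(2) by auto
  qed
  have orth: "dotp G f = 0" "dotp H f = 0" and deg: "degle a G" "degle b H"
    using G(1) H(1) by (simp_all add: syzygy_def)
  \<comment> \<open>\<open>G\<close> and \<open>H\<close> are both orthogonal to \<open>f\<close>,
    so their cross product is a multiple of \<open>f\<close>. Fibrewise independence leaves only a
    constant factor, and comparing degrees yields \<open>a + b = d\<close>.\<close>
  have "cross (cross G H) f = (dotp G f) *s H - (dotp H f) *s G"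
    by (simp add: vec3_eq_iff dotp_def algebra_simps)
  then obtain u where u: "cross G H = u *s f"
    using cross_eq_0_factor[of "cross G H" f] f_ev orth by auto
  have u_ev: "poly u s \<noteq> 0" for s
    using ev_indep[of s] u by (auto simp: pev_cross[symmetric] vec_eq_iff)
  then have "degree u = 0" using alg_closed_imp_poly_has_root[of u] by blast
  then obtain k where k: "u = [:k:]" by (meson degree_eq_zeroE)
  have u_nz: "u \<noteq> 0" using u_ev[of 0] by auto
  have "d \<le> a + b"
    using degree_factor_le[OF f_deg f_top _ u_nz, of "a + b"] degle_cross[OF deg] u by simp
  moreover have "a + b \<le> d"
  proof -
    have "topc (a + b) (cross G H) \<noteq> 0" using top_indep by (simp add: topc_cross[OF deg])
    then obtain i where "coeff (f$i) (a + b) \<noteq> 0" unfolding u k by (auto simp: vec_eq_iff)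
    then show ?thesis using f_deg le_degree unfolding degle_def by (metis le_trans)
  qed
  ultimately have "a + b = d" by simp
  moreover have "splitting_basis f a b G H"
    using ev_indep top_indep G(1) H(1) by (simp add: splitting_basis_def)
  ultimately show ?thesis using that ab by blast
qed

text \<open>If \<open>e < a\<close>, the cross product of \<open>S\<close> with \<open>G\<close> or
  \<open>H\<close> is a multiple of \<open>f\<close> of degree less than \<open>a + b = d\<close>,
  hence zero. Then \<open>S\<close> is parallel to two independent vectors in each fibre, so it
  vanishes.\<close>

lemma splitting_basis_least:
  fixes f :: "'k::alg_closed_field poly ^ 3"
  assumes bpf: "base_point_free d f" and ab: "a \<le> b" "a + b = d"
    and basis: "splitting_basis f a b G H"
    and S: "syzygy f e S" "S \<noteq> 0"
  shows "a \<le> e"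
proof (rule ccontr)
  assume "\<not> a \<le> e"
  have f_deg: "degle d f" and f_ev: "\<And>s. pev f s \<noteq> 0" and f_top: "topc d f \<noteq> 0"
    using bpf by (auto simp: base_point_free_def)
  have vanish: "cross S T = 0" if T: "syzygy f c T" "c \<le> b" for T c
  proof -
    have "cross (cross S T) f = (dotp S f) *s T - (dotp T f) *s S"
      by (simp add: vec3_eq_iff dotp_def algebra_simps)
    then obtain u where u: "cross S T = u *s f"
      using cross_eq_0_factor[of "cross S T" f] f_ev S(1) T(1) by (auto simp: syzygy_def)
    have "u = 0"
    proof (rule ccontr)
      assume "u \<noteq> 0"
      then have "degree u + d \<le> e + c"
        using degree_factor_le[OF f_deg f_top, of "e + c" u] degle_cross[of e S c T] u S(1) T(1)
        by (simp add: syzygy_def)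
      then show False using \<open>\<not> a \<le> e\<close> ab T(2) by simp
    qed
    then show ?thesis using u by simp
  qed
  have "cross S G = 0" "cross S H = 0"
    using vanish basis ab by (auto simp: splitting_basis_def)
  then have c0: "cross (pev S s) (pev G s) = 0" "cross (pev S s) (pev H s) = 0" for s
    by (simp_all add: pev_cross[symmetric] vec_eq_iff)
  have ind: "cross (pev G s) (pev H s) \<noteq> 0" for s using basis by (simp add: splitting_basis_def)
  have "pev S s = 0" for s
  proof (rule ccontr)
    assume S0: "pev S s \<noteq> 0"
    have "cross (pev G s) (pev S s) = 0" "cross (pev H s) (pev S s) = 0"
      using c0[of s] by (simp_all add: vec3_eq_iff algebra_simps)
    then obtain x y where "pev G s = x *s pev S s" "pev H s = y *s pev S s"
      using cross_eq_0_imp_parallel[OF _ S0] by metis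
    then show False using ind[of s] by (simp add: vec3_eq_iff algebra_simps)
  qed
  then show False using S(2) pev_eq_0_imp by blast
qed

text \<open>Orthogonality at all points \<open>(s : 1)\<close> is a polynomial identity, as the
  field is infinite; conversely the identity gives orthogonality at \<open>(1 : 0)\<close> by
  comparing top coefficients.\<close>

lemma pullback_Omega1_splits_iff:
  fixes F :: "'k::alg_closed_field forms"
  assumes F: "is_forms F"
  shows "pullback_Omega1_splits F a b \<longleftrightarrow> (\<exists>G H. splitting_basis (snd F) a b G H)"
proof
  assume "pullback_Omega1_splits F a b"
  then obtain G H where GH: "is_forms G" "fst G = a" "is_forms H" "fst H = b"
    and v: "\<And>v. v \<noteq> 0 \<Longrightarrow> pairing (ev G v) (ev F v) = 0 \<and> pairing (ev H v) (ev F v) = 0 \<and>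
                        lin_indep2 (ev G v) (ev H v)"
    unfolding pullback_Omega1_splits_def by blast
  have s: "dotp (pev (snd G) s) (pev (snd F) s) = 0" "dotp (pev (snd H) s) (pev (snd F) s) = 0"
    "cross (pev (snd G) s) (pev (snd H) s) \<noteq> 0" for s
    using v[OF vec2_nonzero(1), of s] F GH
    by (simp_all add: ev_affine_vector pairing_eq_dotp lin_indep2_iff_cross)
  have "cross (topc a (snd G)) (topc b (snd H)) \<noteq> 0"
    using v[OF vec2_nonzero(2)] F GH
    by (simp add: ev_infinity_vector lin_indep2_iff_cross)
  moreover have "dotp (snd G) (snd F) = 0" "dotp (snd H) (snd F) = 0"
    using s(1,2) by (auto intro!: poly_eq_0_if_all_roots simp: pev_dotp)
  ultimately show "\<exists>G H. splitting_basis (snd F) a b G H"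
    using s(3) GH by (intro exI[of _ "snd G"] exI[of _ "snd H"])
      (auto simp: splitting_basis_def syzygy_def is_forms_iff_degle)
next
  assume "\<exists>G H. splitting_basis (snd F) a b G H"
  then obtain G H where B: "splitting_basis (snd F) a b G H" by blast
  then have deg: "is_forms (a, G)" "is_forms (b, H)" and dot: "dotp G (snd F) = 0" "dotp H (snd F) = 0"
    by (auto simp: splitting_basis_def syzygy_def is_forms_iff_degle)
  have sc: "dotp (x *s u) (y *s w) = x * y * dotp u w" "cross (x *s u) (y *s w) = (x * y) *s cross u w"
    for x y :: 'k and u w
    by (simp_all add: dotp_def vec3_eq_iff algebra_simps)
  have "pairing (ev (a, G) v) (ev F v) = 0 \<and> pairing (ev (b, H) v) (ev F v) = 0 \<and>
          lin_indep2 (ev (a, G) v) (ev (b, H) v)" if "v \<noteq> 0" for v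
  proof (cases "v$2 = 0")
    case True
    then have "v$1 \<noteq> 0" using that by (auto simp: vec_eq_iff forall_2)
    moreover have "dotp (topc a G) (topc (fst F) (snd F)) = 0" "dotp (topc b H) (topc (fst F) (snd F)) = 0"
      using F deg dot topc_dotp by (metis is_forms_iff_degle coeff_0 fst_conv snd_conv)+
    ultimately show ?thesis using True B
      by (simp add: ev_infinity pairing_eq_dotp lin_indep2_iff_cross sc splitting_basis_def)
  next
    case False
    have "dotp (pev G s) (pev (snd F) s) = 0" "dotp (pev H s) (pev (snd F) s) = 0" for s
      using dot by (metis pev_dotp poly_0)+
    then show ?thesis using False F deg B
      by (simp add: ev_affine pairing_eq_dotp lin_indep2_iff_cross sc splitting_basis_def)
  qed
  then show "pullback_Omega1_splits F a b"
    unfolding pullback_Omega1_splits_def using deg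
    by (intro exI[of _ "(a, G)"] exI[of _ "(b, H)"]) auto
qed

text \<open>The definite description in \<open>splitting_type\<close> needs uniqueness: for two
  splittings, each first basis vector is a nonzero syzygy, so minimality applied both ways equates
  the smaller degrees, and the sum fixes the larger ones.\<close>

lemma splitting_type_le:
  fixes D :: "'k::alg_closed_field blowup_point set"
  defines "F \<equiv> fst (parametrization D)"
  assumes F: "is_morphism F" and S: "syzygy (snd F) e S" "S \<noteq> 0"
  shows "split_a D \<le> int e" "split_a D + split_b D = dot_L D"
proof -
  have bpf: "base_point_free (fst F) (snd F)" and forms: "is_forms F"
    using F is_morphism_iff[of F] by (auto simp only: is_morphism_def)
  obtain a b G H where ab: "a \<le> b" "a + b = fst F" "splitting_basis (snd F) a b G H"
    using ex_splitting_basis[OF bpf] by blast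
  have "splitting_type D = (a, b)"
    unfolding splitting_type_def
  proof (rule the_equality)
    show "case (a, b) of (a, b) \<Rightarrow> a \<le> b \<and> int (a + b) = dot_L D \<and>
        pullback_Omega1_splits (fst (parametrization D)) a b"
      using ab forms unfolding F_def dot_L_def by (auto simp: pullback_Omega1_splits_iff)
  next
    fix x assume x: "case x of (a, b) \<Rightarrow> a \<le> b \<and> int (a + b) = dot_L D \<and>
        pullback_Omega1_splits (fst (parametrization D)) a b"
    obtain a' b' where x': "x = (a', b')" by fastforce
    obtain G' H' where ab': "a' \<le> b'" "a' + b' = fst F" "splitting_basis (snd F) a' b' G' H'"
      using x forms unfolding x' F_def dot_L_def by (auto simp: pullback_Omega1_splits_iff)
    have nz: "G \<noteq> 0" "G' \<noteq> 0"
      using ab(3) ab'(3) by (auto simp: splitting_basis_def vec3_eq_iff)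
    have "a \<le> a'"
      using splitting_basis_least[OF bpf ab, of a' G'] ab'(3) nz by (simp add: splitting_basis_def)
    moreover have "a' \<le> a"
      using splitting_basis_least[OF bpf ab', of a G] ab(3) nz by (simp add: splitting_basis_def)
    ultimately show "x = (a, b)" using ab(2) ab'(2) x' by simp
  qed
  then show "split_a D \<le> int e" "split_a D + split_b D = dot_L D"
    using splitting_basis_least[OF bpf ab S] ab(2)
    by (simp_all add: split_a_def split_b_def dot_L_def F_def)
qed

subsection \<open>Ternary forms on a rational curve\<close>

text \<open>Exponents of the monomials \<open>x^a y^b z^(n - a - b)\<close>; the exponent of
  \<open>z\<close> stays implicit, and the same index set serves the affine form at
  \<open>z = 1\<close>.\<close>

definition tri :: "nat \<Rightarrow> (nat \<times> nat) set" where
  "tri n = (SIGMA a:{..n}. {..n - a})"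

lemma mem_tri [simp]: "(a, b) \<in> tri n \<longleftrightarrow> a + b \<le> n"
  by (auto simp: tri_def)

lemma finite_tri [simp]: "finite (tri n)"
  by (simp add: tri_def)

lemma card_tri: "2 * card (tri n) = (n + 1) * (n + 2)"
proof -
  have "card (tri n) = (\<Sum>a\<le>n. n - a + 1)" by (simp add: tri_def)
  also have "\<dots> = (\<Sum>a\<le>n. a + 1)"
    by (rule sum.reindex_bij_witness[of _ "\<lambda>a. n - a" "\<lambda>a. n - a"]) auto
  finally have c: "card (tri n) = (\<Sum>a\<le>n. a + 1)" .
  show ?thesis unfolding c by (induction n) auto
qed

definition ternary :: "nat \<Rightarrow> (nat \<times> nat \<Rightarrow> 'k::field) \<Rightarrow> 'k poly ^ 3 \<Rightarrow> 'k poly" where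
  "ternary n c f = (\<Sum>(a, b)\<in>tri n. smult (c (a, b)) (f$1 ^ a * f$2 ^ b * f$3 ^ (n - a - b)))"

lemma degree_power_le': "degree p \<le> m \<Longrightarrow> degree (p ^ a) \<le> a * m" for p :: "'k::field poly"
  by (metis degree_power_le le_trans mult.commute mult_le_mono1)

lemma degree_mult_le': "degree p \<le> m \<Longrightarrow> degree q \<le> n \<Longrightarrow> degree (p * q) \<le> m + n"
  for p q :: "'k::field poly"
  by (meson add_mono degree_mult_le le_trans)

lemma degree_ternary_le:
  assumes "degle d f"
  shows "degree (ternary n c f) \<le> n * d"
  unfolding ternary_def
proof (intro degree_sum_le finite_tri)
  fix x assume "x \<in> tri n"
  then obtain a b where x: "x = (a, b)" "a + b \<le> n" by (cases x) auto
  have "degree (f$1 ^ a * f$2 ^ b * f$3 ^ (n - a - b)) \<le> a * d + b * d + (n - a - b) * d"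
    using assms by (intro degree_mult_le' degree_power_le') (auto simp: degle_def)
  also have "\<dots> = (a + b + (n - a - b)) * d" by (simp only: add_mult_distrib)
  also have "\<dots> = n * d" using x(2) by simp
  finally have "degree (smult (c (a, b)) (f$1 ^ a * f$2 ^ b * f$3 ^ (n - a - b))) \<le> n * d"
    by (rule order.trans[OF degree_smult_le])
  then show "degree (case x of (a, b) \<Rightarrow> smult (c (a, b)) (f$1 ^ a * f$2 ^ b * f$3 ^ (n - a - b))) \<le> n * d"
    by (simp only: x(1) prod.case)
qed

text \<open>If a form of degree \<open>n < d\<close> vanished on the curve, it would vanish on every line
  \<open>x = \<mu> y + \<nu> z\<close> meeting the curve in \<open>d\<close> distinct points. As the curve is immersed and injectively
  parametrized away from finitely many points, almost all lines through a suitable point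
  \<open>(\<mu> : 1 : 0)\<close> do.\<close>

lemma ternary_eq_0_imp:
  fixes f :: "'k::alg_closed_field poly ^ 3" and B :: "('k ^ 3) set"
  defines "good \<equiv> \<lambda>s. \<forall>q\<in>B. cross (pev f s) q \<noteq> 0"
  assumes bpf: "base_point_free d f" and f3: "f$3 \<noteq> 0"
    and B: "finite B" "\<And>q. q \<in> B \<Longrightarrow> q$3 = 1" "\<And>q. q \<in> B \<Longrightarrow> \<exists>s. cross (pev f s) q \<noteq> 0"
    and inj: "\<And>s t. good s \<Longrightarrow> good t \<Longrightarrow> cross (pev f s) (pev f t) = 0 \<Longrightarrow> s = t"
    and imm: "\<And>s. good s \<Longrightarrow> cross (pev f s) (pev (\<chi> i. pderiv (f$i)) s) \<noteq> 0"
    and n: "n < d" and zero: "ternary n c f = 0"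
  shows "\<forall>x\<in>tri n. c x = 0"
proof -
  have f_deg: "degree (f$i) \<le> d" and f_ev: "pev f s \<noteq> 0" and f_top: "topc d f \<noteq> 0" for i s
    using bpf by (auto simp: base_point_free_def degle_def)
  have inf: "infinite (UNIV :: 'k set)" by (rule infinite_UNIV_alg_closed)
  have ex_new: "\<exists>x. x \<notin> X" if "finite X" for X :: "'k set"
    using ex_new_if_finite[OF inf that] .
  \<comment> \<open>Two components of the cross product of \<open>f\<close> with its derivative. At
    a good \<open>s\<close> with \<open>f$3\<close> nonzero that product is nonzero and orthogonal
    to \<open>f\<close>, so its third component cannot be the only nonzero one.\<close>
  define W1 where "W1 = f$2 * pderiv (f$3) - f$3 * pderiv (f$2)"
  define W2 where "W2 = f$3 * pderiv (f$1) - f$1 * pderiv (f$3)"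
  have W12: "W1 \<noteq> 0 \<or> W2 \<noteq> 0"
  proof -
    have fin_bad: "finite {s. cross (pev f s) q = 0}" if q: "q \<in> B" for q
    proof -
      define Q where "Q = cross f (\<chi> i. [:q$i:])"
      have Q: "pev Q s = cross (pev f s) q" for s
        by (simp add: Q_def vec3_eq_iff)
      obtain s0 where "pev Q s0 \<noteq> 0" using B(3)[OF q] Q by auto
      then obtain i where "poly (Q$i) s0 \<noteq> 0" by (auto simp: vec_eq_iff)
      then have "finite {s. poly (Q$i) s = 0}" by (intro poly_roots_finite) auto
      moreover have "{s. cross (pev f s) q = 0} \<subseteq> {s. poly (Q$i) s = 0}"
        unfolding Q[symmetric] by (auto simp: vec_eq_iff)
      ultimately show ?thesis by (rule rev_finite_subset)
    qed
    have "finite ({s. poly (f$3) s = 0} \<union> (\<Union>q\<in>B. {s. cross (pev f s) q = 0}))"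
      using fin_bad B(1) poly_roots_finite[OF f3] by auto
    from ex_new[OF this] obtain s
      where s: "s \<notin> {s. poly (f$3) s = 0} \<union> (\<Union>q\<in>B. {s. cross (pev f s) q = 0})" ..
    then have g: "good s" and s3: "poly (f$3) s \<noteq> 0" by (auto simp: good_def)
    let ?D = "cross (pev f s) (pev (\<chi> i. pderiv (f$i)) s)"
    have "?D$1 * poly (f$1) s + ?D$2 * poly (f$2) s + ?D$3 * poly (f$3) s = 0"
      by (simp add: algebra_simps)
    moreover have "?D$1 = poly W1 s" "?D$2 = poly W2 s"
      by (simp_all add: W1_def W2_def)
    ultimately show ?thesis using imm[OF g] s3 by (auto simp: vec3_eq_iff)
  qed
  \<comment> \<open>The centre \<open>(\<mu> : 1 : 0)\<close> is chosen off the curve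
    (\<open>mu_ev\<close>, and \<open>mu_top\<close> for the parameter \<open>(1 : 0)\<close>) and
    such that projection from it is not ramified everywhere (\<open>mu_W\<close>); in positive
    characteristic special centres can violate the latter.\<close>
  obtain \<mu> where mu_W: "smult \<mu> W1 + W2 \<noteq> 0"
    and mu_ev: "\<And>s. poly (f$3) s = 0 \<Longrightarrow> poly (f$1) s \<noteq> \<mu> * poly (f$2) s"
    and mu_top: "coeff (f$3) d = 0 \<Longrightarrow> coeff (f$1) d \<noteq> \<mu> * coeff (f$2) d"
  proof -
    define M1 where "M1 = {\<mu>. smult \<mu> W1 + W2 = 0}"
    define M2 where "M2 = (\<lambda>s. poly (f$1) s / poly (f$2) s) ` {s. poly (f$3) s = 0}"
    define M3 where "M3 = {coeff (f$1) d / coeff (f$2) d}"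
    have "x = y" if "x \<in> M1" "y \<in> M1" for x y
    proof (rule ccontr)
      assume "x \<noteq> y"
      have "smult x W1 = smult y W1"
        using that by (metis (mono_tags, lifting) M1_def add_right_cancel mem_Collect_eq)
      then have "smult (x - y) W1 = 0" by (simp add: smult_diff_left)
      then have "W1 = 0" using \<open>x \<noteq> y\<close> by simp
      then show False using that W12 by (simp add: M1_def)
    qed
    then have "finite M1" by (metis finite.simps is_singletonI' is_singleton_def)
    then have "finite (M1 \<union> M2 \<union> M3)"
      using poly_roots_finite[OF f3] by (simp add: M2_def M3_def)
    from ex_new[OF this] obtain \<mu> where mu: "\<mu> \<notin> M1 \<union> M2 \<union> M3" ..
    have 1: "smult \<mu> W1 + W2 \<noteq> 0" using mu by (simp add: M1_def)
    have 2: "poly (f$1) s \<noteq> \<mu> * poly (f$2) s" if s: "poly (f$3) s = 0" for s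
    proof
      assume e: "poly (f$1) s = \<mu> * poly (f$2) s"
      then have "poly (f$2) s \<noteq> 0" using f_ev[of s] s by (auto simp: vec3_eq_iff)
      then have "\<mu> = poly (f$1) s / poly (f$2) s" using e by simp
      then show False using mu s by (auto simp: M2_def)
    qed
    have 3: "coeff (f$1) d \<noteq> \<mu> * coeff (f$2) d" if s: "coeff (f$3) d = 0"
    proof
      assume e: "coeff (f$1) d = \<mu> * coeff (f$2) d"
      then have "coeff (f$2) d \<noteq> 0" using f_top s by (auto simp: vec3_eq_iff)
      then have "\<mu> = coeff (f$1) d / coeff (f$2) d" using e by simp
      then show False using mu by (auto simp: M3_def)
    qed
    show ?thesis using that 1 2 3 by blast
  qed
  define W where "W = smult \<mu> W1 + W2"
  \<comment> \<open>Lines through the centre to be avoided: those through ramification points,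
    through the image of \<open>(1 : 0)\<close> and through points of \<open>B\<close>. A zero
    denominator yields the value 0 and at worst excludes one more line.\<close>
  define bad where "bad = (\<lambda>s. (poly (f$1) s - \<mu> * poly (f$2) s) / poly (f$3) s) ` {s. poly W s = 0}
    \<union> {(coeff (f$1) d - \<mu> * coeff (f$2) d) / coeff (f$3) d} \<union> (\<lambda>q. q$1 - \<mu> * q$2) ` B"
  have fin_bad: "finite bad"
    using poly_roots_finite[OF mu_W] B(1) by (auto simp: bad_def W_def)
  have on_line: "(\<Sum>(a, b)\<in>tri n. c (a, b) * ((\<mu> * y + \<nu>) ^ a * y ^ b)) = 0"
    if lam: "\<nu> \<notin> bad" for \<nu> y
  proof -
    \<comment> \<open>The roots of \<open>r\<close> are the parameters at which the curve meets the
      line. The line misses the image of \<open>(1 : 0)\<close>, so \<open>r\<close> has degree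
      exactly \<open>d\<close>.\<close>
    define r where "r = f$1 - smult \<mu> (f$2) - smult \<nu> (f$3)"
    have r_top: "coeff r d \<noteq> 0"
    proof
      assume "coeff r d = 0"
      then have e: "coeff (f$1) d - \<mu> * coeff (f$2) d = \<nu> * coeff (f$3) d"
        by (simp add: r_def)
      then have "coeff (f$3) d \<noteq> 0" using mu_top by auto
      then have "\<nu> = (coeff (f$1) d - \<mu> * coeff (f$2) d) / coeff (f$3) d" using e by simp
      then show False using lam by (simp add: bad_def)
    qed
    moreover have "degree r \<le> d" unfolding r_def
      using f_deg by (intro degree_diff_le order.trans[OF degree_smult_le]) auto
    ultimately have r_deg: "degree r = d" using le_degree by (metis le_antisym)
    have root: "poly (f$1) s = \<mu> * poly (f$2) s + \<nu> * poly (f$3) s" if "poly r s = 0" for s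
      using that by (simp add: r_def algebra_simps)
    have root3: "poly (f$3) s \<noteq> 0" if "poly r s = 0" for s
      using root[OF that] mu_ev[of s] by auto
    have root_good: "good s" if s: "poly r s = 0" for s
      unfolding good_def
    proof (intro ballI notI)
      fix q assume q: "q \<in> B" "cross (pev f s) q = 0"
      then have "q \<noteq> 0" using B(2)[OF q(1)] by auto
      then obtain k where k: "pev f s = k *s q" using cross_eq_0_imp_parallel q(2) by blast
      then have comps: "poly (f$i) s = k * q$i" for i by (metis pev_nth vector_smult_component)
      then have "k \<noteq> 0" using root3[OF s] by auto
      have "k * (q$1) = k * (\<mu> * q$2 + \<nu>)"
        using root[OF s] comps B(2)[OF q(1)] by (simp add: algebra_simps)
      then have "\<nu> = q$1 - \<mu> * q$2" using \<open>k \<noteq> 0\<close> by simp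
      then show False using lam q(1) by (auto simp: bad_def)
    qed
    have simple: "poly (pderiv r) s \<noteq> 0" if s: "poly r s = 0" for s
    proof
      have "pderiv r = pderiv (f$1) - smult \<mu> (pderiv (f$2)) - smult \<nu> (pderiv (f$3))"
        by (simp add: r_def pderiv_diff pderiv_smult)
      moreover assume "poly (pderiv r) s = 0"
      ultimately have "poly (pderiv (f$1)) s - \<mu> * poly (pderiv (f$2)) s - \<nu> * poly (pderiv (f$3)) s = 0"
        by simp
      then have d1: "poly (pderiv (f$1)) s = \<mu> * poly (pderiv (f$2)) s + \<nu> * poly (pderiv (f$3)) s"
        by (simp add: algebra_simps)
      \<comment> \<open>A multiple root means tangency to the line, that is, a ramification point of
        the projection.\<close>
      have "poly W s = 0"
        unfolding W_def W1_def W2_def by (simp add: d1 root[OF s] algebra_simps)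
      moreover have "\<nu> = (poly (f$1) s - \<mu> * poly (f$2) s) / poly (f$3) s"
        using root[OF s] root3[OF s] by (simp add: field_simps)
      ultimately show False using lam by (auto simp: bad_def)
    qed
    have r0: "r \<noteq> 0" using r_top by auto
    have card: "card {s. poly r s = 0} = d"
      using card_roots_simple[OF r0] simple r_deg by simp
    \<comment> \<open>The affine coordinate \<open>y / z\<close> along the line; it separates the
      intersection points because good points are injectively parametrized.\<close>
    define slope where "slope s = poly (f$2) s / poly (f$3) s" for s
    have pt: "pev f s = poly (f$3) s *s vector [\<mu> * slope s + \<nu>, slope s, 1]" if "poly r s = 0" for s
      using root[OF that] root3[OF that] by (simp add: vec3_eq_iff slope_def field_simps)
    have "inj_on slope {s. poly r s = 0}"
    proof (rule inj_onI)
      fix s t assume st: "s \<in> {s. poly r s = 0}" "t \<in> {s. poly r s = 0}" "slope s = slope t"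
      then have "cross (pev f s) (pev f t) = 0"
        using pt[of s] pt[of t] by (simp add: vec3_eq_iff algebra_simps)
      then show "s = t" using inj root_good st by blast
    qed
    then have card_slope: "card (slope ` {s. poly r s = 0}) = d" using card by (simp add: card_image)
    define Q where "Q = (\<Sum>(a, b)\<in>tri n. smult (c (a, b)) ([:\<nu>, \<mu>:] ^ a * [:0, 1:] ^ b))"
    have Q_poly: "poly Q x = (\<Sum>(a, b)\<in>tri n. c (a, b) * ((\<mu> * x + \<nu>) ^ a * x ^ b))" for x
      by (simp add: Q_def poly_sum case_prod_beta poly_power algebra_simps)
    have Q_root: "poly Q (slope s) = 0" if s: "poly r s = 0" for s
    proof -
      have "0 = poly (ternary n c f) s" using zero by simp
      also have "\<dots> = (\<Sum>(a, b)\<in>tri n. c (a, b) * (poly (f$1) s ^ a * poly (f$2) s ^ b * poly (f$3) s ^ (n - a - b)))"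
        by (simp add: ternary_def poly_sum case_prod_beta poly_power)
      also have "\<dots> = (\<Sum>(a, b)\<in>tri n. poly (f$3) s ^ n * (c (a, b) * ((\<mu> * slope s + \<nu>) ^ a * slope s ^ b)))"
      proof (rule sum.cong, simp, clarify)
        fix a b assume ab: "(a, b) \<in> tri n"
        define z where "z = poly (f$3) s"
        have e: "poly (f$1) s = z * (\<mu> * slope s + \<nu>)" "poly (f$2) s = z * slope s"
          using root3[OF s] root[OF s] by (simp_all add: slope_def z_def field_simps)
        have "z ^ n = z ^ a * z ^ b * z ^ (n - a - b)"
          using ab by (simp add: power_add[symmetric])
        then show "c (a, b) * (poly (f$1) s ^ a * poly (f$2) s ^ b * poly (f$3) s ^ (n - a - b)) =
            poly (f$3) s ^ n * (c (a, b) * ((\<mu> * slope s + \<nu>) ^ a * slope s ^ b))"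
          unfolding e power_mult_distrib z_def[symmetric] by (simp only: mult_ac)
      qed
      also have "\<dots> = poly (f$3) s ^ n * poly Q (slope s)"
        unfolding Q_poly by (simp add: sum_distrib_left case_prod_beta)
      finally show ?thesis using root3[OF s] by simp
    qed
    have Q_deg: "degree Q \<le> n" unfolding Q_def
    proof (intro degree_sum_le finite_tri)
      fix x assume "x \<in> tri n"
      then obtain a b where x: "x = (a, b)" "a + b \<le> n" by (cases x) auto
      have "degree ([:\<nu>, \<mu>:] ^ a * [:0, 1:] ^ b) \<le> a * 1 + b * 1"
        by (intro degree_mult_le' degree_power_le') auto
      then show "degree (case x of (a, b) \<Rightarrow> smult (c (a, b)) ([:\<nu>, \<mu>:] ^ a * [:0, 1:] ^ b)) \<le> n"
        using x degree_smult_le[of "c (a, b)" "[:\<nu>, \<mu>:] ^ a * [:0, 1:] ^ b"] by simp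
    qed
    \<comment> \<open>The form restricted to the line has degree at most \<open>n\<close>, but
      \<open>d > n\<close> distinct roots.\<close>
    have "Q = 0"
    proof (rule ccontr)
      assume Q0: "Q \<noteq> 0"
      have "slope ` {s. poly r s = 0} \<subseteq> {x. poly Q x = 0}" using Q_root by auto
      then have "d \<le> card {x. poly Q x = 0}"
        using card_mono[OF poly_roots_finite[OF Q0]] card_slope by metis
      also have "\<dots> \<le> degree Q" by (rule card_poly_roots_bound[OF Q0])
      finally show False using Q_deg n by simp
    qed
    then show ?thesis using Q_poly[of y] by simp
  qed
  \<comment> \<open>For fixed \<open>y\<close>, the numbers \<open>\<mu> * y + \<nu>\<close> with
    \<open>\<nu>\<close> outside \<open>bad\<close> are infinitely many zeros of the affine form as
    a polynomial in \<open>x\<close>; hence each of its coefficients vanishes.\<close>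
  have rows: "(\<Sum>b\<le>n - a. c (a, b) * y ^ b) = 0" if a: "a \<le> n" for a y
  proof -
    define R where "R = (\<Sum>a\<le>n. monom (\<Sum>b\<le>n - a. c (a, b) * y ^ b) a)"
    have "poly R (\<mu> * y + \<nu>) = 0" if "\<nu> \<notin> bad" for \<nu>
    proof -
      have "poly R (\<mu> * y + \<nu>) = (\<Sum>a\<le>n. \<Sum>b\<le>n - a. c (a, b) * ((\<mu> * y + \<nu>) ^ a * y ^ b))"
        by (simp add: R_def poly_sum poly_monom sum_distrib_left sum_distrib_right mult_ac)
      also have "\<dots> = (\<Sum>(a, b)\<in>tri n. c (a, b) * ((\<mu> * y + \<nu>) ^ a * y ^ b))"
        unfolding tri_def by (rule sum.Sigma) auto
      finally show ?thesis using on_line[OF that] by simp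
    qed
    then have "(\<lambda>\<nu>. \<mu> * y + \<nu>) ` (- bad) \<subseteq> {x. poly R x = 0}" by auto
    moreover have "infinite ((\<lambda>\<nu>. \<mu> * y + \<nu>) ` (- bad))"
      using fin_bad inf by (subst finite_image_iff) (auto simp: inj_on_def Compl_eq_Diff_UNIV)
    ultimately have "R = 0" using poly_roots_finite finite_subset by blast
    then have "coeff R a = 0" by simp
    then show ?thesis using a by (simp add: R_def coeff_sum)
  qed
  have "c (a, b) = 0" if ab: "a + b \<le> n" for a b
  proof -
    define R where "R = (\<Sum>b\<le>n - a. monom (c (a, b)) b)"
    have "poly R y = 0" for y
      using rows[of a y] ab by (simp add: R_def poly_sum poly_monom)
    then have "R = 0" by (rule poly_eq_0_if_all_roots)
    then have "coeff R b = 0" by simp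
    moreover have "b \<le> n - a" using ab by simp
    ultimately show ?thesis by (simp add: R_def coeff_sum)
  qed
  then show ?thesis by auto
qed

section \<open>Taylor expansion of ternary forms and multiplicity at a point\<close>

lemma sum_tri_extend:
  assumes "a + b \<le> n" and "\<And>x y. x > a \<or> y > b \<Longrightarrow> F (x, y) = 0"
  shows "(\<Sum>x\<le>a. \<Sum>y\<le>b. F (x, y)) = (\<Sum>z\<in>tri n. F z)"
proof -
  have "(\<Sum>x\<le>a. \<Sum>y\<le>b. F (x, y)) = (\<Sum>z\<in>{..a} \<times> {..b}. F z)"
    by (simp add: sum.cartesian_product)
  also have "\<dots> = (\<Sum>z\<in>tri n. F z)"
    using assms by (intro sum.mono_neutral_left) (auto, (metis not_le)+)
  finally show ?thesis .
qed

text \<open>The coefficient of \<open>(X - p)^x (Y - q)^y\<close> in the affine form, a Hasse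
  derivative, so that its vanishing for \<open>x + y < k\<close> means multiplicity at least
  \<open>k\<close> in every characteristic. Where the natural subtraction truncates, the binomial
  coefficient is 0.\<close>

definition taylor :: "nat \<Rightarrow> (nat \<times> nat \<Rightarrow> 'k::field) \<Rightarrow> 'k \<Rightarrow> 'k \<Rightarrow> nat \<times> nat \<Rightarrow> 'k" where
  "taylor n c p q = (\<lambda>(x, y). \<Sum>(a, b)\<in>tri n.
     of_nat (a choose x) * p ^ (a - x) * (of_nat (b choose y) * q ^ (b - y)) * c (a, b))"

lemma smult_sum_right: "smult c (\<Sum>i\<in>S. F i) = (\<Sum>i\<in>S. smult c (F i))"
  by (induct S rule: infinite_finite_induct) (auto simp: smult_add_right)

lemma power_shift:
  fixes u v :: "'k::field poly"
  shows "(u + smult p v) ^ a = (\<Sum>x\<le>a. smult (of_nat (a choose x) * p ^ (a - x)) (u ^ x * v ^ (a - x)))"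
  by (simp add: binomial_ring of_nat_poly smult_power mult.commute)

lemma ternary_taylor:
  fixes f :: "'k::field poly ^ 3"
  assumes u: "f$1 = u + smult p (f$3)" and w: "f$2 = w + smult q (f$3)"
  shows "ternary n c f =
    (\<Sum>(x, y)\<in>tri n. smult (taylor n c p q (x, y)) (u ^ x * w ^ y * f$3 ^ (n - x - y)))"
proof -
  define K where "K = (\<lambda>a b (x, y). of_nat (a choose x) * p ^ (a - x) * (of_nat (b choose y) * q ^ (b - y)))"
  define M where "M = (\<lambda>(x, y). u ^ x * w ^ y * f$3 ^ (n - x - y))"
  have expand: "f$1 ^ a * f$2 ^ b * f$3 ^ (n - a - b) = (\<Sum>z\<in>tri n. smult (K a b z) (M z))"
    if ab: "a + b \<le> n" for a b
  proof -
    have "f$1 ^ a * f$2 ^ b * f$3 ^ (n - a - b) =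
      (\<Sum>x\<le>a. \<Sum>y\<le>b. smult (of_nat (a choose x) * p ^ (a - x)) (u ^ x * f$3 ^ (a - x)) *
         smult (of_nat (b choose y) * q ^ (b - y)) (w ^ y * f$3 ^ (b - y)) * f$3 ^ (n - a - b))"
      unfolding u w power_shift by (simp only: sum_product) (simp only: sum_distrib_right)
    also have "\<dots> = (\<Sum>x\<le>a. \<Sum>y\<le>b. smult (K a b (x, y)) (M (x, y)))"
    proof (intro sum.cong refl)
      fix x y assume "x \<in> {..a}" "y \<in> {..b}"
      then have "f$3 ^ (n - x - y) = f$3 ^ (a - x) * f$3 ^ (b - y) * f$3 ^ (n - a - b)"
        using ab by (simp add: power_add[symmetric])
      then show "smult (of_nat (a choose x) * p ^ (a - x)) (u ^ x * f$3 ^ (a - x)) *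
         smult (of_nat (b choose y) * q ^ (b - y)) (w ^ y * f$3 ^ (b - y)) * f$3 ^ (n - a - b) =
         smult (K a b (x, y)) (M (x, y))"
        by (simp add: K_def M_def mult_ac)
    qed
    also have "\<dots> = (\<Sum>z\<in>tri n. smult (K a b z) (M z))"
      using ab by (intro sum_tri_extend) (auto simp: K_def binomial_eq_0)
    finally show ?thesis .
  qed
  have "smult (c (a, b)) (f$1 ^ a * f$2 ^ b * f$3 ^ (n - a - b)) =
      (\<Sum>z\<in>tri n. smult (K a b z * c (a, b)) (M z))" if "a + b \<le> n" for a b
    unfolding expand[OF that] smult_sum_right by (simp add: mult.commute)
  then have "ternary n c f = (\<Sum>(a, b)\<in>tri n. \<Sum>z\<in>tri n. smult (K a b z * c (a, b)) (M z))"
    unfolding ternary_def by (intro sum.cong refl) (clarify, simp only: mem_tri)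
  also have "\<dots> = (\<Sum>z\<in>tri n. \<Sum>(a, b)\<in>tri n. smult (K a b z * c (a, b)) (M z))"
    unfolding case_prod_beta by (rule sum.swap)
  also have "\<dots> = (\<Sum>(x, y)\<in>tri n. smult (taylor n c p q (x, y)) (u ^ x * w ^ y * f$3 ^ (n - x - y)))"
    by (intro sum.cong refl)
       (auto simp: taylor_def K_def M_def smult_sum case_prod_beta)
  finally show ?thesis .
qed

text \<open>In terms of binary forms, \<open>h\<close> has degree \<open>m\<close> and \<open>f\<close> has degree \<open>m + e\<close>; \<open>h\<close> cuts out the
  fibre over the point \<open>(p, q)\<close>.\<close>

lemma ternary_factor:
  fixes f :: "'k::field poly ^ 3"
  assumes u: "f$1 - smult p (f$3) = h * u" and w: "f$2 - smult q (f$3) = h * w"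
    and deg: "degree h \<le> m" "degree u \<le> e" "degree w \<le> e" "degree (f$3) \<le> m + e"
    and zero: "\<And>x y. x + y < k \<Longrightarrow> x + y \<le> n \<Longrightarrow> taylor n c p q (x, y) = 0"
  obtains Q where "ternary n c f = h ^ k * Q" "Q \<noteq> 0 \<Longrightarrow> degree Q + m * k \<le> n * (m + e)"
proof -
  \<comment> \<open>The Taylor term at \<open>(x, y)\<close> carries the factor
    \<open>h ^ (x + y)\<close>, and the terms with \<open>x + y < k\<close> are zero;
    \<open>M\<close> is what remains of the monomial after division by \<open>h ^ k\<close>.\<close>
  define M where "M = (\<lambda>(x, y). h ^ (x + y - k) * u ^ x * w ^ y * f$3 ^ (n - x - y))"
  define Z where "Z = {z \<in> tri n. k \<le> fst z + snd z}"
  define Q where "Q = (\<Sum>z\<in>Z. smult (taylor n c p q z) (M z))"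
  have fu: "f$1 = h * u + smult p (f$3)" "f$2 = h * w + smult q (f$3)"
    using u w by (simp_all add: algebra_simps)
  have "ternary n c f =
    (\<Sum>(x, y)\<in>tri n. smult (taylor n c p q (x, y)) ((h * u) ^ x * (h * w) ^ y * f$3 ^ (n - x - y)))"
    by (rule ternary_taylor[OF fu])
  also have "\<dots> = (\<Sum>(x, y)\<in>Z. smult (taylor n c p q (x, y)) ((h * u) ^ x * (h * w) ^ y * f$3 ^ (n - x - y)))"
  proof (rule sum.mono_neutral_right)
    have "taylor n c p q (x, y) = 0" if "(x, y) \<in> tri n - Z" for x y
      using that zero[of x y] by (auto simp: Z_def)
    then show "\<forall>z\<in>tri n - Z. (case z of (x, y) \<Rightarrow>
        smult (taylor n c p q (x, y)) ((h * u) ^ x * (h * w) ^ y * f$3 ^ (n - x - y))) = 0"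
      by auto
  qed (auto simp: Z_def)
  also have "\<dots> = (\<Sum>z\<in>Z. h ^ k * smult (taylor n c p q z) (M z))"
  proof (intro sum.cong refl)
    fix z assume "z \<in> Z"
    then obtain x y where z: "z = (x, y)" "k \<le> x + y" by (cases z) (auto simp: Z_def)
    then have "h ^ (x + y) = h ^ k * h ^ (x + y - k)" by (simp add: power_add[symmetric])
    moreover have "(h * u) ^ x * (h * w) ^ y = h ^ (x + y) * (u ^ x * w ^ y)"
      by (simp add: power_mult_distrib power_add mult_ac)
    ultimately have hxy: "(h * u) ^ x * (h * w) ^ y = h ^ k * h ^ (x + y - k) * (u ^ x * w ^ y)"
      by (simp only:)
    show "(case z of (x, y) \<Rightarrow> smult (taylor n c p q (x, y)) ((h * u) ^ x * (h * w) ^ y * f$3 ^ (n - x - y)))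
      = h ^ k * smult (taylor n c p q z) (M z)"
      by (simp only: z(1) prod.case M_def hxy mult_smult_right) (simp only: mult_ac)
  qed
  finally have eq: "ternary n c f = h ^ k * Q" by (simp add: Q_def sum_distrib_left)
  \<comment> \<open>The bound involves the formal degree \<open>m\<close> rather than
    \<open>degree h\<close>, so it also records a zero of \<open>h\<close> at
    \<open>(1 : 0)\<close>. The condition on \<open>Q\<close> ensures
    \<open>k \<le> n\<close>.\<close>
  have "degree Q + m * k \<le> n * (m + e)" if "Q \<noteq> 0"
  proof -
    have "Z \<noteq> {}" using that by (auto simp: Q_def)
    then have kn: "k \<le> n" by (auto simp: Z_def)
    have "degree Q \<le> n * (m + e) - m * k" unfolding Q_def
    proof (intro degree_sum_le)
      show "finite Z" by (simp add: Z_def)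
      fix z assume "z \<in> Z"
      then obtain x y where z: "z = (x, y)" "k \<le> x + y" "x + y \<le> n" by (cases z) (auto simp: Z_def)
      obtain i where i: "x + y = k + i" using z(2) le_Suc_ex by blast
      obtain j where j: "n = x + y + j" using z(3) le_Suc_ex by blast
      have "degree (M z) \<le> (x + y - k) * m + x * e + y * e + (n - x - y) * (m + e)"
        unfolding M_def z(1) prod.case using deg
        by (intro degree_mult_le' degree_power_le')
      also have "\<dots> + m * k = n * (m + e)"
      proof -
        have "x + y - k = i" "n - x - y = j" "n = k + i + j" using i j by simp_all
        moreover have "x * e + y * e = (k + i) * e" using i by (metis add_mult_distrib)
        ultimately show ?thesis by (simp add: algebra_simps)
      qed
      finally have "degree (M z) \<le> n * (m + e) - m * k" by simp
      then show "degree (smult (taylor n c p q z) (M z)) \<le> n * (m + e) - m * k"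
        using degree_smult_le le_trans by blast
    qed
    moreover have "m * k \<le> n * (m + e)" using kn by (metis mult.commute mult_le_mono le_add1)
    ultimately show ?thesis by simp
  qed
  with eq show ?thesis using that by blast
qed

text \<open>Coefficients of \<open>x g + y g'\<close> at \<open>z = 1\<close>, for \<open>g\<close>,
  \<open>g'\<close> with coefficients \<open>c\<close>, \<open>c'\<close>. Those with
  \<open>a + b = n + 1\<close> belong to monomials without \<open>z\<close>; once they vanish, the
  others are the coefficients of \<open>(x g + y g') / z\<close>.\<close>

definition third_coeff :: "(nat \<times> nat \<Rightarrow> 'k::field) \<Rightarrow> (nat \<times> nat \<Rightarrow> 'k) \<Rightarrow> nat \<times> nat \<Rightarrow> 'k" where
  "third_coeff c c' = (\<lambda>(a, b). (if a = 0 then 0 else c (a - 1, b)) + (if b = 0 then 0 else c' (a, b - 1)))"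

lemma ternary_relation:
  fixes f :: "'k::field poly ^ 3"
  assumes "\<And>a b. a + b = n + 1 \<Longrightarrow> third_coeff c c' (a, b) = 0"
  shows "f$1 * ternary n c f + f$2 * ternary n c' f = f$3 * ternary n (third_coeff c c') f"
proof -
  define X where "X = (\<lambda>(a, b). f$1 ^ a * f$2 ^ b * f$3 ^ (n + 1 - a - b))"
  have 1: "f$1 * ternary n c f = (\<Sum>(a, b)\<in>tri (n + 1). smult (if a = 0 then 0 else c (a - 1, b)) (X (a, b)))"
  proof -
    have "f$1 * ternary n c f = (\<Sum>(a, b)\<in>tri n. smult (c (a, b)) (X (a + 1, b)))"
      unfolding ternary_def sum_distrib_left by (intro sum.cong refl) (auto simp: X_def mult_ac)
    also have "\<dots> = (\<Sum>(a, b)\<in>{z \<in> tri (n + 1). fst z \<noteq> 0}. smult (c (a - 1, b)) (X (a, b)))"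
      by (rule sum.reindex_bij_witness[of _ "\<lambda>(a, b). (a - 1, b)" "\<lambda>(a, b). (a + 1, b)"]) auto
    also have "\<dots> = (\<Sum>(a, b)\<in>tri (n + 1). smult (if a = 0 then 0 else c (a - 1, b)) (X (a, b)))"
      by (rule sum.mono_neutral_cong_left) (auto split: if_splits)
    finally show ?thesis .
  qed
  have 2: "f$2 * ternary n c' f = (\<Sum>(a, b)\<in>tri (n + 1). smult (if b = 0 then 0 else c' (a, b - 1)) (X (a, b)))"
  proof -
    have "f$2 * ternary n c' f = (\<Sum>(a, b)\<in>tri n. smult (c' (a, b)) (X (a, b + 1)))"
      unfolding ternary_def sum_distrib_left by (intro sum.cong refl) (auto simp: X_def mult_ac)
    also have "\<dots> = (\<Sum>(a, b)\<in>{z \<in> tri (n + 1). snd z \<noteq> 0}. smult (c' (a, b - 1)) (X (a, b)))"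
      by (rule sum.reindex_bij_witness[of _ "\<lambda>(a, b). (a, b - 1)" "\<lambda>(a, b). (a, b + 1)"]) auto
    also have "\<dots> = (\<Sum>(a, b)\<in>tri (n + 1). smult (if b = 0 then 0 else c' (a, b - 1)) (X (a, b)))"
      by (rule sum.mono_neutral_cong_left) (auto split: if_splits)
    finally show ?thesis .
  qed
  have "f$1 * ternary n c f + f$2 * ternary n c' f =
      (\<Sum>(a, b)\<in>tri (n + 1). smult (third_coeff c c' (a, b)) (X (a, b)))"
    unfolding 1 2 sum.distrib[symmetric]
    by (intro sum.cong refl) (auto simp: third_coeff_def smult_add_left[symmetric])
  also have "\<dots> = (\<Sum>(a, b)\<in>tri n. smult (third_coeff c c' (a, b)) (X (a, b)))"
  proof (rule sum.mono_neutral_right)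
    have "third_coeff c c' (a, b) = 0" if "a + b \<le> n + 1" "\<not> a + b \<le> n" for a b
      using that by (intro assms) simp
    then show "\<forall>z\<in>tri (n + 1) - tri n. (case z of (a, b) \<Rightarrow> smult (third_coeff c c' (a, b)) (X (a, b))) = 0"
      by auto
  qed auto
  also have "\<dots> = f$3 * ternary n (third_coeff c c') f"
    unfolding ternary_def sum_distrib_left
    by (intro sum.cong refl) (auto simp: X_def Suc_diff_le mult_ac)
  finally show ?thesis .
qed

text \<open>The vector field of components \<open>c, c', - third_coeff c c'\<close> is a section of \<open>\<Omega>(1)\<close> twisted by
  \<open>n\<close>; it exists because there are fewer conditions than coefficients.\<close>

lemma ex_form_with_multiplicities:
  fixes p q :: "'i::finite \<Rightarrow> 'k::field" and k :: "'i \<Rightarrow> nat"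
  assumes count: "(\<Sum>i\<in>UNIV. k i * (k i + 1)) < n * (n + 2)"
  obtains c c' where "\<exists>z\<in>tri n. c z \<noteq> 0 \<or> c' z \<noteq> 0"
    "\<And>a b. a + b = n + 1 \<Longrightarrow> third_coeff c c' (a, b) = 0"
    "\<And>i x y. x + y < k i \<Longrightarrow> taylor n c (p i) (q i) (x, y) = 0 \<and> taylor n c' (p i) (q i) (x, y) = 0"
proof -
  define T where "T i = (SIGMA x:{..<k i}. {..<k i - x})" for i
  \<comment> \<open>One condition for each of the \<open>n + 2\<close> monomials of degree
    \<open>n + 1\<close> without \<open>z\<close>, and one for each form, point and Taylor
    coefficient. The third component receives its multiplicities later, as the points lie off
    \<open>z = 0\<close>.\<close>
  define J where "J = {..n+1} <+> (SIGMA i:UNIV. (UNIV :: bool set) \<times> T i)"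
  define I where "I = (UNIV :: bool set) \<times> tri n"
  have T: "2 * card (T i) = k i * (k i + 1)" for i
  proof -
    have "(\<Sum>x<m. m - x) = (\<Sum>x<m. x + 1)" for m :: nat
      by (rule sum.reindex_bij_witness[of _ "\<lambda>x. m - 1 - x" "\<lambda>x. m - 1 - x"]) auto
    moreover have "2 * (\<Sum>x<m. x + 1) = m * (m + 1)" for m :: nat by (induction m) auto
    ultimately show ?thesis by (simp add: T_def)
  qed
  have finT: "finite (T i)" for i by (simp add: T_def)
  have "card J = n + 2 + (\<Sum>i\<in>UNIV. 2 * card (T i))"
    unfolding J_def by (subst card_Plus) (auto simp: finT card_SigmaI card_cartesian_product)
  then have "card J = n + 2 + (\<Sum>i\<in>UNIV. k i * (k i + 1))" by (simp only: T)
  moreover have "card I = (n + 1) * (n + 2)"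
    using card_tri[of n] by (simp add: I_def card_cartesian_product)
  moreover have "(n + 1) * (n + 2) = n + 2 + n * (n + 2)" by simp
  ultimately have lt: "card J < card I" using count by linarith
  \<comment> \<open>The Boolean selects the form: \<open>True\<close> is multiplied by
    \<open>x\<close>, which raises the exponent to \<open>a + 1\<close>, and \<open>False\<close> by
    \<open>y\<close>, which leaves it at \<open>a\<close>.\<close>
  define A where "A = (\<lambda>j z. case z of (l, a, b) \<Rightarrow> (case j of
      Inl t \<Rightarrow> if a + b = n \<and> t = (if l then a + 1 else a) then 1 else 0
    | Inr (i, l', x, y) \<Rightarrow> if l = l' then of_nat (a choose x) * p i ^ (a - x) *
        (of_nat (b choose y) * q i ^ (b - y)) else (0 :: 'k)))"
  have "finite J" "finite I" by (auto simp: J_def I_def finT)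
  from underdetermined_system[OF this lt, of A] obtain X where
    X: "\<exists>z\<in>I. X z \<noteq> 0" "\<And>j. j \<in> J \<Longrightarrow> (\<Sum>z\<in>I. A j z * X z) = 0" by blast
  define c where "c l = (\<lambda>z. X (l, z))" for l
  have split: "(\<Sum>z\<in>I. F z) = (\<Sum>z\<in>tri n. F (True, z)) + (\<Sum>z\<in>tri n. F (False, z))"
    for F :: "_ \<Rightarrow> 'k"
  proof -
    have "(\<Sum>z\<in>I. F z) = (\<Sum>l\<in>UNIV. \<Sum>z\<in>tri n. F (l, z))"
      unfolding I_def by (simp add: sum.cartesian_product)
    then show ?thesis by (simp add: UNIV_bool add.commute)
  qed
  show ?thesis
  proof (rule that[of "c True" "c False"])
    show "\<exists>z\<in>tri n. c True z \<noteq> 0 \<or> c False z \<noteq> 0"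
      using X(1) unfolding I_def c_def by (metis (full_types) SigmaE)
  next
    fix a b :: nat assume ab: "a + b = n + 1"
    have delta: "(\<Sum>z\<in>tri n. (if z = z0 \<and> P then 1 else 0) * F z) = (if z0 \<in> tri n \<and> P then F z0 else 0)"
      for F :: "nat \<times> nat \<Rightarrow> 'k" and z0 P
    proof -
      have "(\<Sum>z\<in>tri n. (if z = z0 \<and> P then 1 else 0) * F z) = (\<Sum>z\<in>tri n. if z = z0 then (if P then F z0 else 0) else 0)"
        by (intro sum.cong) auto
      then show ?thesis by (simp add: sum.delta)
    qed
    have A1: "A (Inl a) (True, z) = (if z = (a - 1, b) \<and> a \<noteq> 0 then 1 else 0)"
      "A (Inl a) (False, z) = (if z = (a, b - 1) \<and> b \<noteq> 0 then 1 else 0)" if "z \<in> tri n" for z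
      using ab that by (cases z; auto simp: A_def)+
    have "0 = (\<Sum>z\<in>tri n. A (Inl a) (True, z) * c True z) + (\<Sum>z\<in>tri n. A (Inl a) (False, z) * c False z)"
    proof -
      have "Inl a \<in> J" unfolding J_def using ab by (intro InlI) simp
      from X(2)[OF this] show ?thesis by (simp only: split c_def)
    qed
    also have "\<dots> = third_coeff (c True) (c False) (a, b)"
      using ab by (simp add: A1 delta third_coeff_def del: mem_tri cong: sum.cong) auto
    finally show "third_coeff (c True) (c False) (a, b) = 0" by simp
  next
    fix i x y assume xy: "x + y < k i"
    have "(\<Sum>z\<in>I. A (Inr (i, l, x, y)) z * X z) = taylor n (c l) (p i) (q i) (x, y)" for l
      unfolding split taylor_def c_def A_def by (cases l) (simp_all add: case_prod_beta)
    moreover have "Inr (i, l, x, y) \<in> J" for l unfolding J_def T_def using xy by (intro InrI) auto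
    ultimately show "taylor n (c True) (p i) (q i) (x, y) = 0 \<and> taylor n (c False) (p i) (q i) (x, y) = 0"
      using X(2) by metis
  qed
qed

text \<open>Each component of the restricted section is divisible by the product of the
  \<open>h i ^ k i\<close>, since distinct points have disjoint fibres. The quotient has formal
  degree \<open>n * d - (\<Sum>i\<in>UNIV. k i * m i)\<close>, the number
  \<open>A \<cdot> E\<close>.\<close>

lemma ex_low_degree_syzygy:
  fixes f :: "'k::alg_closed_field poly ^ 3" and p q :: "'i::finite \<Rightarrow> 'k"
  assumes bpf: "base_point_free d f"
    and distinct: "\<And>i j. p i = p j \<Longrightarrow> q i = q j \<Longrightarrow> i = j"
    and u: "\<And>i. f$1 - smult (p i) (f$3) = h i * u i"
    and w: "\<And>i. f$2 - smult (q i) (f$3) = h i * w i"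
    and deg: "\<And>i. degree (h i) \<le> m i" "\<And>i. m i \<le> d"
      "\<And>i. degree (u i) \<le> d - m i" "\<And>i. degree (w i) \<le> d - m i"
    and h_nz: "\<And>i. h i \<noteq> 0"
    and count: "(\<Sum>i\<in>UNIV. k i * (k i + 1)) < n * (n + 2)"
    and e: "n * d \<le> e + (\<Sum>i\<in>UNIV. k i * m i)"
    and nonvanishing: "\<And>c. ternary n c f = 0 \<Longrightarrow> \<forall>z\<in>tri n. c z = 0"
  obtains S where "syzygy f e S" "S \<noteq> 0"
proof -
  have f_deg: "degle d f" and f_ev: "\<And>s. pev f s \<noteq> 0" and f_top: "topc d f \<noteq> 0"
    using bpf by (auto simp: base_point_free_def)
  have f_degi: "degree (f$i) \<le> d" for i using f_deg by (simp add: degle_def)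
  have at_root: "poly (f$1) s = p i * poly (f$3) s" "poly (f$2) s = q i * poly (f$3) s" "poly (f$3) s \<noteq> 0"
    if "poly (h i) s = 0" for i s
  proof -
    show 1: "poly (f$1) s = p i * poly (f$3) s"
      using arg_cong[OF u[of i], of "\<lambda>x. poly x s"] that by simp
    show 2: "poly (f$2) s = q i * poly (f$3) s"
      using arg_cong[OF w[of i], of "\<lambda>x. poly x s"] that by simp
    show "poly (f$3) s \<noteq> 0" using 1 2 f_ev[of s] by (auto simp: vec3_eq_iff)
  qed
  \<comment> \<open>A degree drop means that \<open>h i\<close>, as a form of degree
    \<open>m i\<close>, vanishes at \<open>(1 : 0)\<close>; then \<open>(1 : 0)\<close> maps to the
    point with index \<open>i\<close>, so this happens for at most one \<open>i\<close>.\<close>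
  have at_infinity: "coeff (f$1) d = p i * coeff (f$3) d" "coeff (f$2) d = q i * coeff (f$3) d"
      "coeff (f$3) d \<noteq> 0"
    if "degree (h i) < m i" for i
  proof -
    have "degree (h i * u i) < d" "degree (h i * w i) < d"
      using degree_mult_le[of "h i" "u i"] degree_mult_le[of "h i" "w i"] deg[of i] that by linarith+
    then have c: "coeff (h i * u i) d = 0" "coeff (h i * w i) d = 0"
      by (auto intro: coeff_eq_0)
    show 1: "coeff (f$1) d = p i * coeff (f$3) d"
      using arg_cong[OF u[of i], of "\<lambda>x. coeff x d"] c by simp
    show 2: "coeff (f$2) d = q i * coeff (f$3) d"
      using arg_cong[OF w[of i], of "\<lambda>x. coeff x d"] c by simp
    show "coeff (f$3) d \<noteq> 0" using 1 2 f_top by (auto simp: vec3_eq_iff)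
  qed
  have h_coprime: "\<not> (poly (h i) s = 0 \<and> poly (h j) s = 0)" if "i \<noteq> j" for i j s
    using at_root[of i s] at_root[of j s] distinct that by (metis mult_right_cancel)
  have inf_unique: "i = j" if "degree (h i) < m i" "degree (h j) < m j" for i j
    using at_infinity[OF that(1)] at_infinity[OF that(2)] distinct by (metis mult_right_cancel)
  define H where "H = (\<Prod>i\<in>UNIV. h i ^ k i)"
  have H_nz: "H \<noteq> 0" using h_nz by (simp add: H_def)
  have H_deg: "degree H = (\<Sum>i\<in>UNIV. k i * degree (h i))"
    using h_nz by (simp add: H_def degree_prod_eq_sum_degree degree_power_eq)
  obtain c c' where c: "\<exists>z\<in>tri n. c z \<noteq> 0 \<or> c' z \<noteq> 0"
    and rel: "\<And>a b. a + b = n + 1 \<Longrightarrow> third_coeff c c' (a, b) = 0"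
    and mult: "\<And>i x y. x + y < k i \<Longrightarrow> taylor n c (p i) (q i) (x, y) = 0"
      "\<And>i x y. x + y < k i \<Longrightarrow> taylor n c' (p i) (q i) (x, y) = 0"
    using ex_form_with_multiplicities[OF count, of p q] by metis
  have quot: "\<exists>S. ternary n b f = H * S \<and> degree S \<le> e"
    if b: "\<And>i x y. x + y < k i \<Longrightarrow> taylor n b (p i) (q i) (x, y) = 0" for b
  proof -
    have fac: "\<exists>Q. ternary n b f = h i ^ k i * Q \<and> (Q \<noteq> 0 \<longrightarrow> degree Q + m i * k i \<le> n * d)" for i
    proof -
      have "degree (f$3) \<le> m i + (d - m i)" using f_degi deg(2)[of i] by simp
      then obtain Q where "ternary n b f = h i ^ k i * Q" "Q \<noteq> 0 \<Longrightarrow> degree Q + m i * k i \<le> n * (m i + (d - m i))"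
        using ternary_factor[OF u[of i] w[of i] deg(1)[of i] deg(3)[of i] deg(4)[of i]] b by metis
      then show ?thesis using deg(2)[of i] by auto
    qed
    have "h i ^ k i dvd ternary n b f" for i using fac[of i] by auto
    then have "H dvd ternary n b f"
      unfolding H_def using h_coprime by (intro prod_pairwise_coprime_polys_dvd) auto
    then obtain S where S: "ternary n b f = H * S" ..
    have "degree S \<le> e" if S_nz: "S \<noteq> 0"
    proof -
      have S_deg: "degree (ternary n b f) = degree H + degree S"
        using S H_nz S_nz by (simp add: degree_mult_eq)
      \<comment> \<open>Without a degree drop, \<open>H\<close> has the full degree. Otherwise the
        missing degree comes from a single \<open>i\<close>, and the sharper bound of
        \<open>fac\<close> for this \<open>i\<close> makes up for it.\<close>
      show ?thesis
      proof (cases "\<exists>i. degree (h i) < m i")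
        case False
        then have "degree (h i) = m i" for i using deg(1)[of i] by (metis le_neq_implies_less)
        then have "degree H = (\<Sum>i\<in>UNIV. k i * m i)" by (simp add: H_deg)
        then show ?thesis using S_deg degree_ternary_le[OF f_deg, of n b] e by linarith
      next
        case True
        then obtain i where i: "degree (h i) < m i" by blast
        then have full: "degree (h j) = m j" if "j \<noteq> i" for j
          using inf_unique deg(1)[of j] that by (metis le_neq_implies_less)
        obtain Q where Q: "ternary n b f = h i ^ k i * Q" "Q \<noteq> 0 \<longrightarrow> degree Q + m i * k i \<le> n * d"
          using fac[of i] by blast
        have "Q \<noteq> 0" using Q(1) S S_nz H_nz by auto
        then have "degree (ternary n b f) = k i * degree (h i) + degree Q"
          using Q(1) h_nz[of i] by (simp add: degree_mult_eq degree_power_eq)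
        moreover have "degree H = k i * degree (h i) + (\<Sum>j\<in>UNIV - {i}. k j * m j)"
          unfolding H_deg by (subst sum.remove[of _ i]) (auto simp: full)
        moreover have "(\<Sum>j\<in>UNIV. k j * m j) = k i * m i + (\<Sum>j\<in>UNIV - {i}. k j * m j)"
          by (subst sum.remove[of _ i]) auto
        ultimately show ?thesis
          using S_deg Q(2) \<open>Q \<noteq> 0\<close> e mult.commute[of "k i" "m i"] by linarith
      qed
    qed
    then show ?thesis using S by (cases "S = 0") auto
  qed
  obtain S1 where S1: "ternary n c f = H * S1" "degree S1 \<le> e" using quot[of c] mult(1) by blast
  obtain S2 where S2: "ternary n c' f = H * S2" "degree S2 \<le> e" using quot[of c'] mult(2) by blast
  define A where "A = ternary n (third_coeff c c') f"
  have A: "H * (f$1 * S1 + f$2 * S2) = f$3 * A"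
  proof -
    have "f$1 * ternary n c f + f$2 * ternary n c' f = f$3 * A"
      unfolding A_def by (rule ternary_relation) (rule rel)
    then show ?thesis unfolding S1(1) S2(1) by (simp add: algebra_simps)
  qed
  \<comment> \<open>The fibres \<open>h i = 0\<close> lie over points off \<open>z = 0\<close>, so
    \<open>H\<close> is coprime to \<open>f$3\<close> and divides the third component as
    well.\<close>
  have "H dvd A"
  proof (rule coprime_polys_dvd_mult(1))
    show "\<not> (poly H s = 0 \<and> poly (f$3) s = 0)" for s
      using at_root(3) by (auto simp: H_def poly_prod)
    show "H dvd f$3 * A" by (simp add: A[symmetric])
  qed
  then obtain S3 where S3: "A = H * S3" ..
  have S3_rel: "f$1 * S1 + f$2 * S2 = f$3 * S3"
    using A H_nz unfolding S3 by (metis mult.left_commute mult_left_cancel)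
  \<comment> \<open>If \<open>(1 : 0)\<close> maps to one of the points, \<open>f$3\<close> has
    degree exactly \<open>d\<close> and the syzygy relation bounds \<open>S3\<close>; otherwise
    \<open>H\<close> has full degree.\<close>
  have "degree S3 \<le> e"
  proof (cases "S3 = 0 \<or> (\<exists>i. degree (h i) < m i)")
    case True
    show ?thesis
    proof (cases "S3 = 0")
      case False
      then obtain i where "degree (h i) < m i" using True by blast
      then have c3: "coeff (f$3) d \<noteq> 0" using at_infinity(3) by blast
      then have "degree (f$3) = d" using f_degi le_degree by (metis le_antisym)
      moreover have "f$3 \<noteq> 0" using c3 by auto
      ultimately have "degree (f$3 * S3) = d + degree S3" using False by (simp add: degree_mult_eq)
      moreover have "degree (f$1 * S1 + f$2 * S2) \<le> d + e"
        using S1(2) S2(2) f_degi by (intro degree_add_le degree_mult_le')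
      ultimately show ?thesis using S3_rel by simp
    qed simp
  next
    case False
    then have "degree (h i) = m i" for i using deg(1)[of i] by (metis le_neq_implies_less)
    then have "degree H = (\<Sum>i\<in>UNIV. k i * m i)" by (simp add: H_deg)
    moreover have "degree A = degree H + degree S3" using False H_nz by (simp add: S3 degree_mult_eq)
    ultimately show ?thesis using degree_ternary_le[OF f_deg, of n "third_coeff c c'"] e
      unfolding A_def by linarith
  qed
  moreover have "S1 \<noteq> 0 \<or> S2 \<noteq> 0"
    using c nonvanishing[of c] nonvanishing[of c'] S1(1) S2(1) by auto
  moreover have "dotp (vector [S1, S2, - S3]) f = 0"
    using S3_rel by (simp add: dotp_def algebra_simps)
  ultimately have "syzygy f e (vector [S1, S2, - S3])" "vector [S1, S2, - S3] \<noteq> (0 :: 'k poly ^ 3)"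
    using S1(2) S2(2) by (auto simp: syzygy_def degle_def forall_3 vec3_eq_iff)
  then show ?thesis using that by blast
qed

subsection \<open>The geometry of the blow-up\<close>

text \<open>Equal points would satisfy the nontrivial relation that the difference of their first
  coordinates is zero.\<close>

lemma generic_points_inj:
  fixes p :: "9 \<Rightarrow> 'k::field ^ 2"
  assumes gen: "generic_points p" and eq: "p i = p j"
  shows "i = j"
proof (rule ccontr)
  assume "i \<noteq> j"
  define z where "z = (\<lambda>(i :: 9, j :: 2). p i $ j)"
  define e where "e i = (\<lambda>x :: 9 \<times> 2. if x = (i, 1) then 1 else 0 :: nat)" for i
  define c where "c x = (if x = e i then 1 else - 1 :: 'k)" for x
  have ne: "e i \<noteq> e j" using \<open>i \<noteq> j\<close> by (auto simp: e_def fun_eq_iff)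
  have mon: "(\<Prod>x\<in>UNIV. z x ^ e i x) = p i $ 1" for i
  proof -
    have "(\<Prod>x\<in>UNIV. z x ^ e i x) = (\<Prod>x\<in>UNIV. if x = (i, 1) then z x else 1)"
      by (intro prod.cong) (auto simp: e_def)
    then show ?thesis by (simp add: z_def)
  qed
  have "1 = of_int 1 / (of_int 1 :: 'k)" "- 1 = of_int (- 1) / (of_int 1 :: 'k)" by simp_all
  then have mem: "c x \<in> prime_subfield" for x unfolding c_def prime_subfield_def by (metis (mono_tags, lifting) mem_Collect_eq)
  have zero: "(\<Sum>x\<in>{e i, e j}. c x * (\<Prod>y\<in>UNIV. z y ^ x y)) = 0"
    using ne eq by (simp add: mon c_def)
  have independent: "finite S \<and> (\<forall>x\<in>S. c x \<in> prime_subfield) \<and>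
      (\<Sum>x\<in>S. c x * (\<Prod>y\<in>UNIV. z y ^ x y)) = 0 \<longrightarrow> (\<forall>x\<in>S. c x = 0)" for S
    using gen unfolding generic_points_def alg_independent_over_def z_def[symmetric] by (elim allE)
  have "\<forall>x\<in>{e i, e j}. c x = 0"
    by (rule independent[THEN mp]) (intro conjI ballI mem zero finite.intros)
  then have "c (e i) = 0" by (rule bspec) simp
  then show False by (simp add: c_def)
qed

lemma dev_affine:
  assumes "is_forms F"
  shows "dev F (vector [s, 1]) (vector [1, 0]) = pev (\<chi> i. pderiv (snd F $ i)) s"
proof -
  have "coeff (\<Sum>j\<le>N. smult (coeff q j) ([:s, 1:] ^ j * [:1, 0:] ^ (N - j))) 1 = poly (pderiv q) s"
    if "degree q \<le> N" for q :: "'a poly" and N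
  proof -
    have one: "[:1, 0:] = (1 :: 'a poly)" by (simp add: one_pCons)
    have "coeff (\<Sum>j\<le>N. smult (coeff q j) ([:s, 1:] ^ j * [:1, 0:] ^ (N - j))) 1
        = (\<Sum>j\<le>N. coeff q j * (of_nat j * s ^ (j - 1)))"
    proof -
      have "coeff ([:s, 1:] ^ j) 1 = of_nat j * s ^ (j - 1)" for j
        using coeff_linear_poly_power[of 1 j s 1] by (cases "j = 0") simp_all
      then show ?thesis unfolding one by (simp add: coeff_sum)
    qed
    \<comment> \<open>Padding by a zero term, so that the index can be shifted by one to reach the
      coefficients of the derivative.\<close>
    also have "\<dots> = (\<Sum>j\<le>Suc N. coeff q j * (of_nat j * s ^ (j - 1)))"
      using that by (simp add: coeff_eq_0)
    also have "\<dots> = (\<Sum>j\<le>N. coeff (pderiv q) j * s ^ j)"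
      unfolding sum.atMost_Suc_shift by (simp add: coeff_pderiv mult_ac del: of_nat_Suc)
    also have "\<dots> = poly (pderiv q) s"
      by (intro poly_sum_le[symmetric] degree_le) (use that in \<open>auto simp: coeff_pderiv coeff_eq_0\<close>)
    finally show ?thesis .
  qed
  then show ?thesis using assms by (simp add: dev_def vec_eq_iff is_forms_def)
qed

lemma pev_const [simp]: "pev (\<chi> j. [:q $ j:]) s = q"
  by (simp add: vec_eq_iff)

lemma pderiv_dotp:
  "pderiv (dotp F G) = dotp (\<chi> i. pderiv (F$i)) G + dotp F (\<chi> i. pderiv (G$i))"
  by (simp add: dotp_def pderiv_add pderiv_mult algebra_simps)

text \<open>Such an \<open>f\<close> is \<open>f$3\<close> times \<open>q\<close>, and base point
  freeness forbids \<open>f$3\<close> a zero anywhere, including \<open>(1 : 0)\<close>. This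
  describes curves contracted to a point.\<close>

lemma base_point_free_parallel_const:
  fixes f :: "'k::alg_closed_field poly ^ 3"
  assumes bpf: "base_point_free d f" and "cross (\<chi> j. [:q$j:]) f = 0" and q: "q$3 = 1"
  shows "d = 0" and "pev f s = poly (f$3) s *s q" and "poly (f$3) s \<noteq> 0"
proof -
  have e: "f$1 = smult (q$1) (f$3)" "f$2 = smult (q$2) (f$3)"
    using assms(2) q by (simp_all add: vec3_eq_iff)
  show par: "pev f s = poly (f$3) s *s q" for s using e q by (simp add: vec3_eq_iff mult.commute)
  have ev: "poly (f$3) s \<noteq> 0" for s
    using bpf par[of s] by (auto simp: base_point_free_def)
  then show "poly (f$3) s \<noteq> 0" .
  have "degree (f$3) = 0" using alg_closed_imp_poly_has_root[of "f$3"] ev by blast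
  moreover have "coeff (f$3) d \<noteq> 0"
    using bpf e by (auto simp: base_point_free_def vec3_eq_iff)
  ultimately show "d = 0" using le_degree by fastforce
qed

lemma vector_2_eq_iff: "x = y \<longleftrightarrow> x$1 = y$1 \<and> x$2 = y$2" for x y :: "'a ^ 2"
  by (simp add: vec_eq_iff forall_2)

lemma param_incidence:
  fixes p :: "9 \<Rightarrow> 'k::field ^ 2"
  assumes sub: "param_image \<phi> \<subseteq> blowup p" and "v \<noteq> 0"
  shows "dotp (ev (snd \<phi> i) v) (ev (fst \<phi>) v) = 0" "dotp (ev (snd \<phi> i) v) (hom_coords (p i)) = 0"
proof -
  have "param_point \<phi> v \<in> blowup p" using sub \<open>v \<noteq> 0\<close> by (auto simp: param_image_def)
  then obtain x w where x: "x \<noteq> 0" "vec.span {ev (fst \<phi>) v} = vec.span {x}"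
    and w: "w \<noteq> 0" "vec.span {ev (snd \<phi> i) v} = vec.span {w}" "dotp w x = 0" "dotp w (hom_coords (p i)) = 0"
    unfolding param_point_def blowup_def pairing_eq_dotp by auto metis
  obtain a where a: "a \<noteq> 0" "x = a *s ev (fst \<phi>) v" using span_singleton_eq[OF x(2,1)] .
  obtain b where b: "b \<noteq> 0" "w = b *s ev (snd \<phi> i) v" using span_singleton_eq[OF w(2,1)] .
  have "dotp w x = b * a * dotp (ev (snd \<phi> i) v) (ev (fst \<phi>) v)"
    "dotp w (hom_coords (p i)) = b * dotp (ev (snd \<phi> i) v) (hom_coords (p i))"
    unfolding a(2) b(2) by (simp_all add: dotp_def algebra_simps)
  then show "dotp (ev (snd \<phi> i) v) (ev (fst \<phi>) v) = 0" "dotp (ev (snd \<phi> i) v) (hom_coords (p i)) = 0"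
    using a(1) b(1) w(3,4) by simp_all
qed

text \<open>Off the points \<open>p\<^sub>i\<close>, the lines \<open>\<lambda>\<^sub>i\<close> are
  determined by the point of the plane, so equal images in the plane mean equal images in the
  blow-up.\<close>

lemma closed_immersion_injective:
  fixes p :: "9 \<Rightarrow> 'k::field ^ 2"
  assumes imm: "closed_immersion \<phi>" and sub: "param_image \<phi> \<subseteq> blowup p"
    and good: "\<And>i. cross (pev (snd (fst \<phi>)) t) (hom_coords (p i)) \<noteq> 0"
    and par: "cross (pev (snd (fst \<phi>)) s) (pev (snd (fst \<phi>)) t) = 0"
  shows "s = t"
proof -
  define f where "f = snd (fst \<phi>)"
  define g where "g i = snd (snd \<phi> i)" for i
  have mor: "is_morphism (fst \<phi>)" "\<And>i. is_morphism (snd \<phi> i)"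
    using imm by (auto simp: closed_immersion_def)
  then have f_ev: "pev f s \<noteq> 0" and g_ev: "pev (g i) s \<noteq> 0" for i s
    unfolding f_def g_def is_morphism_iff base_point_free_def by blast+
  have ev: "ev (fst \<phi>) (vector [s, 1]) = pev f s" "ev (snd \<phi> i) (vector [s, 1]) = pev (g i) s" for i s
    using mor by (simp_all add: f_def g_def is_morphism_def ev_affine_vector)
  have inc: "dotp (pev (g i) s) (pev f s) = 0" "dotp (pev (g i) s) (hom_coords (p i)) = 0" for i s
    using param_incidence[OF sub vec2_nonzero(1), of i s] by (simp_all add: ev)
  obtain k where k: "pev f s = k *s pev f t"
    using cross_eq_0_imp_parallel[of "pev f s" "pev f t"] par f_ev by (auto simp: f_def)
  have k0: "k \<noteq> 0" using k f_ev[of s] by auto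
  have "vec.span {pev (g i) s} = vec.span {pev (g i) t}" for i
  proof -
    have "k * dotp (pev (g i) s) (pev f t) = dotp (pev (g i) s) (pev f s)"
      unfolding k by (simp add: dotp_def algebra_simps)
    then have "dotp (pev (g i) s) (pev f t) = 0" using inc k0 by simp
    then obtain c where c: "pev (g i) s = c *s pev (g i) t"
      using orthogonal_complement_dim1[of "pev f t" "hom_coords (p i)"] good inc g_ev
      unfolding f_def by metis
    then have "c \<noteq> 0" using g_ev[of i s] by auto
    then show ?thesis unfolding c by (rule span_singleton_smult)
  qed
  moreover have "vec.span {pev f s} = vec.span {pev f t}"
    unfolding k using k0 by (rule span_singleton_smult)
  ultimately have "param_point \<phi> (vector [s, 1]) = param_point \<phi> (vector [t, 1])"
    by (simp add: param_point_def ev)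
  then have "vec.span {vector [s, 1]} = vec.span {vector [t, 1 :: 'k] :: 'k ^ 2}"
    using imm vec2_nonzero(1) unfolding closed_immersion_def by blast
  then obtain c where "vector [t, 1] = c *s (vector [s, 1] :: 'k ^ 2)"
    using span_singleton_eq vec2_nonzero(1) by metis
  then show "s = t" by (simp add: vector_2_eq_iff)
qed

text \<open>If the derivative of \<open>f\<close> is parallel to \<open>f\<close>, differentiating
  the two incidence relations shows that the derivative of each \<open>g i\<close> is orthogonal to
  both \<open>f\<close> and \<open>p\<^sub>i\<close>, hence parallel to \<open>g i\<close>. Then
  every component has zero tangent map.\<close>

lemma closed_immersion_immersive:
  fixes p :: "9 \<Rightarrow> 'k::alg_closed_field ^ 2"
  assumes imm: "closed_immersion \<phi>" and sub: "param_image \<phi> \<subseteq> blowup p"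
    and good: "\<And>i. cross (pev (snd (fst \<phi>)) s) (hom_coords (p i)) \<noteq> 0"
  shows "cross (pev (snd (fst \<phi>)) s) (pev (\<chi> j. pderiv (snd (fst \<phi>) $ j)) s) \<noteq> 0"
proof
  define f where "f = snd (fst \<phi>)"
  define g where "g i = snd (snd \<phi> i)" for i
  define D where "D F = (\<chi> j. pderiv (F $ j))" for F :: "'k poly ^ 3"
  have mor: "is_morphism (fst \<phi>)" "\<And>i. is_morphism (snd \<phi> i)"
    using imm by (auto simp: closed_immersion_def)
  then have f_ev: "pev f s \<noteq> 0" and g_ev: "pev (g i) s \<noteq> 0" for i s
    unfolding f_def g_def is_morphism_iff base_point_free_def by blast+
  have ev: "ev (fst \<phi>) (vector [s, 1]) = pev f s" "ev (snd \<phi> i) (vector [s, 1]) = pev (g i) s" for i s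
    using mor by (simp_all add: f_def g_def is_morphism_def ev_affine_vector)
  have inc: "dotp (pev (g i) s) (pev f s) = 0" "dotp (pev (g i) s) (hom_coords (p i)) = 0" for i s
    using param_incidence[OF sub vec2_nonzero(1), of i s] by (simp_all add: ev)
  have inc_poly: "dotp (g i) f = 0" "dotp (g i) (\<chi> j. [:hom_coords (p i) $ j:]) = 0" for i
    by (rule poly_eq_0_if_all_roots, simp add: pev_dotp inc)+
  assume "cross (pev (snd (fst \<phi>)) s) (pev (\<chi> j. pderiv (snd (fst \<phi>) $ j)) s) = 0"
  then have c0: "cross (pev f s) (pev (D f) s) = 0" by (simp add: f_def D_def)
  then have "cross (pev (D f) s) (pev f s) = 0" by (simp add: vec3_eq_iff algebra_simps)
  then obtain k where k: "pev (D f) s = k *s pev f s"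
    using cross_eq_0_imp_parallel f_ev by blast
  have "lin_indep2 (vector [s, 1]) (vector [1, 0] :: 'k ^ 2)"
    by (auto simp: lin_indep2_def vector_2_eq_iff)
  then obtain F where F: "F \<in> insert (fst \<phi>) (range (snd \<phi>))"
    "lin_indep2 (ev F (vector [s, 1])) (dev F (vector [s, 1]) (vector [1, 0]))"
    using imm unfolding closed_immersion_def by blast
  have "is_forms F" using F(1) mor by (auto simp: is_morphism_def)
  then have F2: "cross (pev (snd F) s) (pev (D (snd F)) s) \<noteq> 0"
    using F(2) by (simp add: ev_affine_vector dev_affine lin_indep2_iff_cross D_def)
  then have "F \<noteq> fst \<phi>" using c0 by (auto simp: f_def)
  then obtain i where i: "snd F = g i" using F(1) by (auto simp: g_def)
  have "dotp (D (g i)) f + dotp (g i) (D f) = 0"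
    using pderiv_dotp[of "g i" f] inc_poly(1)[of i] by (simp add: D_def)
  then have "dotp (pev (D (g i)) s) (pev f s) + dotp (pev (g i) s) (pev (D f) s) = 0"
    unfolding pev_dotp[symmetric] by (metis poly_0 poly_add)
  moreover have "dotp (pev (g i) s) (pev (D f) s) = k * dotp (pev (g i) s) (pev f s)"
    unfolding k by (simp add: dotp_def algebra_simps)
  ultimately have 1: "dotp (pev (D (g i)) s) (pev f s) = 0" using inc by simp
  have "D (\<chi> j. [:hom_coords (p i) $ j:]) = 0" by (simp add: D_def vec_eq_iff pderiv_pCons)
  then have "dotp (D (g i)) (\<chi> j. [:hom_coords (p i) $ j:]) = 0"
    using pderiv_dotp[of "g i" "\<chi> j. [:hom_coords (p i) $ j:]"] inc_poly(2)[of i]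
    by (simp add: D_def dotp_def)
  then have "poly (dotp (D (g i)) (\<chi> j. [:hom_coords (p i) $ j:])) s = 0" by simp
  then have 2: "dotp (pev (D (g i)) s) (hom_coords (p i)) = 0" by (simp add: pev_dotp)
  obtain c where "pev (D (g i)) s = c *s pev (g i) s"
    using orthogonal_complement_dim1[OF _ 1 2 inc(1) inc(2) g_ev] good by (auto simp: f_def)
  then show False using F2 i by simp
qed

text \<open>A cubic through the nine points would give \<open>\<Sum> m\<^sub>i \<le> 3 d\<close> if \<open>E\<close> is not a component of it; here
  this bound follows from \<open>E\<^sup>2 = -1\<close> and the Cauchy-Schwarz inequality alone.\<close>

lemma sum_le_of_sum_squares:
  fixes m :: "9 \<Rightarrow> int"
  assumes "(\<Sum>i\<in>UNIV. (m i)\<^sup>2) = d\<^sup>2 + 1" "d \<ge> 2"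
  shows "(\<Sum>i\<in>UNIV. m i) \<le> 3 * d"
proof -
  have "0 \<le> (\<Sum>i\<in>UNIV. (3 * m i - d)\<^sup>2)" by (intro sum_nonneg) auto
  also have "\<dots> = (\<Sum>i\<in>UNIV. 9 * (m i)\<^sup>2 - 6 * d * m i + d\<^sup>2)"
    by (intro sum.cong) (auto simp: power2_eq_square algebra_simps)
  also have "\<dots> = 9 * (\<Sum>i\<in>UNIV. (m i)\<^sup>2) - 6 * d * (\<Sum>i\<in>UNIV. m i) + 9 * d\<^sup>2"
    by (simp add: sum.distrib sum_subtractf sum_distrib_left)
  finally have "2 * d * (\<Sum>i\<in>UNIV. m i) \<le> 6 * d\<^sup>2 + 3" using assms(1) by simp
  show ?thesis
  proof (rule ccontr)
    assume "\<not> ?thesis"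
    \<comment> \<open>By integrality a violation exceeds \<open>3 * d\<close> by at least 1, which
      after multiplication by \<open>2 * d \<ge> 4\<close> is more than the slack of 3.\<close>
    then have "2 * d * (3 * d + 1) \<le> 2 * d * (\<Sum>i\<in>UNIV. m i)"
      using assms(2) by (intro mult_left_mono) auto
    also have "\<dots> \<le> 6 * d\<^sup>2 + 3" by fact
    finally show False using assms(2) by (simp add: power2_eq_square algebra_simps)
  qed
qed

text \<open>The first claim comes from the equality
  \<open>(\<Sum>i\<in>UNIV. k i * (k i + 1)) + 1 = n * (n + 2)\<close>, the surplus of one
  coefficient; the second says \<open>A \<cdot> E \<le> n\<close>.\<close>

lemma numerical_conditions:
  fixes m k :: "9 \<Rightarrow> nat" and n :: nat
  assumes sq: "(\<Sum>i\<in>UNIV. (m i)\<^sup>2) = (2 * n + 2)\<^sup>2 + 1" and m: "\<And>i. m i = 2 * k i + 1"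
  shows "(\<Sum>i\<in>UNIV. k i * (k i + 1)) < n * (n + 2)"
    and "n * (2 * n + 2) \<le> n + (\<Sum>i\<in>UNIV. k i * m i)"
proof -
  define K where "K = (\<Sum>i\<in>UNIV. k i)"
  have "(\<Sum>i\<in>UNIV. (m i)\<^sup>2) = (\<Sum>i\<in>UNIV. 4 * (k i * (k i + 1)) + 1)"
    by (intro sum.cong) (auto simp: m power2_eq_square algebra_simps)
  also have "\<dots> = 4 * (\<Sum>i\<in>UNIV. k i * (k i + 1)) + 9"
    by (simp only: sum.distrib sum_distrib_left[symmetric]) simp
  finally have 1: "4 * (\<Sum>i\<in>UNIV. k i * (k i + 1)) + 9 = (2 * n + 2)\<^sup>2 + 1" using sq by simp
  then have "4 * (\<Sum>i\<in>UNIV. k i * (k i + 1)) + 4 = 4 * (n * (n + 2))"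
    by (simp add: power2_eq_square algebra_simps)
  then have 2: "(\<Sum>i\<in>UNIV. k i * (k i + 1)) + 1 = n * (n + 2)" by linarith
  then show "(\<Sum>i\<in>UNIV. k i * (k i + 1)) < n * (n + 2)" by simp
  have "(\<Sum>i\<in>UNIV. int (m i)) \<le> 3 * int (2 * n + 2)"
  proof (rule sum_le_of_sum_squares)
    show "(\<Sum>i\<in>UNIV. (int (m i))\<^sup>2) = (int (2 * n + 2))\<^sup>2 + 1"
      using arg_cong[OF sq, of int] by simp
  qed simp
  then have "(\<Sum>i\<in>UNIV. m i) \<le> 3 * (2 * n + 2)"
    by (metis of_nat_sum of_nat_mult of_nat_numeral of_nat_le_iff)
  moreover have "(\<Sum>i\<in>UNIV. m i) = 2 * K + 9"
    unfolding K_def by (simp only: m sum.distrib sum_distrib_left[symmetric]) simp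
  \<comment> \<open>Here parity sharpens the bound: \<open>2 * K + 9\<close> is odd and
    \<open>6 * n + 6\<close> is even.\<close>
  ultimately have K: "K + 2 \<le> 3 * n" by arith
  have "(\<Sum>i\<in>UNIV. k i * m i) + K = (\<Sum>i\<in>UNIV. 2 * (k i * (k i + 1)))"
    unfolding K_def sum.distrib[symmetric] by (intro sum.cong) (auto simp: m algebra_simps)
  also have "\<dots> = 2 * (\<Sum>i\<in>UNIV. k i * (k i + 1))" by (rule sum_distrib_left[symmetric])
  finally have "(\<Sum>i\<in>UNIV. k i * m i) + K + 2 = 2 * (n * (n + 2))" using 2 by linarith
  then show "n * (2 * n + 2) \<le> n + (\<Sum>i\<in>UNIV. k i * m i)"
    using K by (simp add: algebra_simps)
qed

theorem theorem3:
  fixes p :: "9 \<Rightarrow> 'k::alg_closed_field ^ 2"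
    and E :: "'k blowup_point set"
  assumes "generic_points p"
    and "exceptional_curve p E"
    and "even (dot_L E)"
    and "\<forall>i. odd (dot_E E i)"
  shows "split_a E \<le> (dot_L E - 2) div 2 \<and> splitting_gap E \<ge> 2"
proof -
  define \<phi> where "\<phi> = parametrization E"
  have "closed_immersion \<phi> \<and> param_image \<phi> = E"
    unfolding \<phi>_def parametrization_def
    by (rule someI_ex) (use assms(2) in \<open>simp add: exceptional_curve_def smooth_rational_curve_def\<close>)
  then have imm: "closed_immersion \<phi>" and sub: "param_image \<phi> \<subseteq> blowup p"
    using assms(2) by (auto simp: exceptional_curve_def smooth_rational_curve_def)
  define d f where "d = fst (fst \<phi>)" and "f = snd (fst \<phi>)"
  define e g where "e i = fst (snd \<phi> i)" and "g i = snd (snd \<phi> i)" for i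
  define P where "P i = hom_coords (p i)" for i
  define cP where "cP i = (\<chi> j. [:P i $ j:])" for i
  have P: "P i $ 1 = p i $ 1" "P i $ 2 = p i $ 2" "P i $ 3 = 1" for i
    by (simp_all add: P_def hom_coords_def)
  have mor: "is_morphism (fst \<phi>)" "\<And>i. is_morphism (snd \<phi> i)"
    using imm by (auto simp: closed_immersion_def)
  then have bpf: "base_point_free d f" and g_bpf: "base_point_free (e i) (g i)" for i
    by (auto simp: is_morphism_iff d_def f_def e_def g_def)
  have ev: "ev (fst \<phi>) (vector [s, 1]) = pev f s" "ev (snd \<phi> i) (vector [s, 1]) = pev (g i) s" for i s
    using mor by (simp_all add: f_def g_def is_morphism_def ev_affine_vector)
  have inc_ev: "dotp (pev (g i) s) (pev f s) = 0" "dotp (pev (g i) s) (P i) = 0" for i s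
    using param_incidence[OF sub vec2_nonzero(1), of i s] by (simp_all add: ev P_def)
  have inc: "dotp (g i) f = 0" "dotp (g i) (cP i) = 0" for i
    by (rule poly_eq_0_if_all_roots, simp add: pev_dotp inc_ev cP_def)+
  \<comment> \<open>\<open>cross (cP i) f\<close> is the line joining \<open>p\<^sub>i\<close> to
    the moving point, and \<open>g i\<close> is the same line with common zeros removed.\<close>
  have "\<exists>h. cross (cP i) f = h *s g i" for i
  proof -
    have "cross (cross (cP i) f) (g i) = dotp (g i) (cP i) *s f - dotp (g i) f *s cP i"
      by (simp add: vec3_eq_iff dotp_def algebra_simps)
    then have "cross (cross (cP i) f) (g i) = 0" by (simp add: inc)
    then obtain h where "cross (cP i) f = h *s g i"
      by (rule cross_eq_0_factor) (use g_bpf[of i] in \<open>auto simp: base_point_free_def\<close>)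
    then show ?thesis ..
  qed
  then obtain h where h: "\<And>i. cross (cP i) f = h i *s g i" by metis
  have h_deg: "degree (h i) + e i \<le> d" if "h i \<noteq> 0" for i
  proof (rule degree_factor_le[OF _ _ _ that])
    show "degle (e i) (g i)" "topc (e i) (g i) \<noteq> 0" using g_bpf[of i] by (auto simp: base_point_free_def)
    have "degle 0 (cP i)" by (simp add: degle_def cP_def)
    then show "degle d (h i *s g i)"
      using degle_cross[of 0 "cP i" d f] bpf h[of i] by (simp add: base_point_free_def)
  qed
  have h_zero: "cross (\<chi> j. [:P i $ j:]) f = 0" if "h i = 0" for i
    using h[of i] that by (simp add: cP_def)
  have odd: "odd (int d - int (e i))" for i
    using assms(4) by (simp add: dot_E_def d_def e_def \<phi>_def)
  \<comment> \<open>If \<open>d = 0\<close>, a nonzero \<open>h i\<close> would force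
    \<open>e i = 0\<close>, against the odd difference. So every \<open>h i\<close> is zero and the
    constant image would be all nine points at once.\<close>
  have d_pos: "d > 0"
  proof (rule ccontr)
    assume "\<not> d > 0"
    then have "h i = 0" for i using h_deg[of i] odd[of i] by (cases "h i = 0") auto
    then have "pev f 0 = poly (f$3) 0 *s P i" "poly (f$3) 0 \<noteq> 0" for i
      using base_point_free_parallel_const[OF bpf h_zero P(3)] by blast+
    then have "P 0 = P 1" by (metis vector_mul_lcancel)
    then have "p 0 = p 1" using P by (metis vector_2_eq_iff)
    then have "(0 :: 9) = 1" using generic_points_inj[OF assms(1)] by blast
    then show False by simp
  qed
  then have h_nz: "h i \<noteq> 0" for i
    using base_point_free_parallel_const(1)[OF bpf h_zero P(3), of i] by auto
  define m where "m i = d - e i" for i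
  have e: "e i \<le> d" "int d - int (e i) = int (m i)" "e i = d - m i" "m i \<le> d" for i
    using h_deg[OF h_nz, of i] by (auto simp: m_def)
  have hm: "degree (h i) \<le> m i" for i using h_deg[OF h_nz, of i] by (simp add: m_def)
  have m_odd: "odd (m i)" for i using odd[of i] unfolding e(2) by simp
  have "even d" using assms(3) by (simp add: dot_L_def d_def \<phi>_def)
  with d_pos obtain n where n: "d = 2 * n + 2"
    by (metis Suc_pred add_2_eq_Suc' dvdE mult_Suc_right nat_0_less_mult_iff add.commute)
  define k where "k i = m i div 2" for i
  have k: "m i = 2 * k i + 1" for i using m_odd[of i] by (simp add: k_def)
  have sq: "(\<Sum>i\<in>UNIV. (m i)\<^sup>2) = (2 * n + 2)\<^sup>2 + 1"
  proof -
    have "dot_E E i = int (m i)" for i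
      using e(2)[of i] by (simp add: dot_E_def d_def e_def \<phi>_def)
    moreover have "dot_L E = int d" by (simp add: dot_L_def d_def \<phi>_def)
    ultimately have "int d * int d - (\<Sum>i\<in>UNIV. int (m i) * int (m i)) = - 1"
      using assms(2) by (simp add: exceptional_curve_def intersection_form_def divisor_class_def)
    then have "int (\<Sum>i\<in>UNIV. (m i)\<^sup>2) = int (d\<^sup>2 + 1)" by (simp add: power2_eq_square)
    then show ?thesis unfolding n by (simp only: of_nat_eq_iff)
  qed
  have u: "f$1 - smult (p i $ 1) (f$3) = h i * g i $ 2" "f$2 - smult (p i $ 2) (f$3) = h i * (- (g i $ 1))" for i
  proof -
    have "cross (cP i) f $ 1 = h i * g i $ 1" "cross (cP i) f $ 2 = h i * g i $ 2"
      by (simp_all add: h)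
    then show "f$1 - smult (p i $ 1) (f$3) = h i * g i $ 2" "f$2 - smult (p i $ 2) (f$3) = h i * (- (g i $ 1))"
      by (simp_all add: cP_def P algebra_simps)
  qed
  \<comment> \<open>The curve is not the line \<open>z = 0\<close>: since \<open>m 0\<close> is odd,
    it passes through the affine point with index 0. If \<open>h 0\<close> is constant, this happens
    at the parameter \<open>(1 : 0)\<close>, where the top coefficients give the
    contradiction.\<close>
  have f3: "f$3 \<noteq> 0"
  proof
    assume f3: "f$3 = 0"
    have f12: "f$1 = h 0 * g 0 $ 2" "f$2 = h 0 * (- (g 0 $ 1))" using u[of 0] f3 by simp_all
    show False
    proof (cases "degree (h 0) = 0")
      case True
      have "m 0 \<noteq> 0" using m_odd[of 0] by (metis even_zero)
      then have "e 0 < d" by (simp add: m_def)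
      moreover have "degree (h 0 * g 0 $ j) \<le> e 0" for j
        using True degree_mult_le[of "h 0" "g 0 $ j"] g_bpf[of 0] order.trans
        by (force simp: base_point_free_def degle_def)
      ultimately have "degree (h 0 * g 0 $ j) < d" for j
        by (rule order.strict_trans1[rotated])
      then have "coeff (f$1) d = 0" "coeff (f$2) d = 0"
        unfolding f12 by (simp_all add: coeff_eq_0)
      then show False using bpf f3 by (simp add: base_point_free_def vec3_eq_iff)
    next
      case False
      then obtain s where "poly (h 0) s = 0" using alg_closed_imp_poly_has_root[of "h 0"] by blast
      then have "pev f s = 0" using f12 f3 by (simp add: vec3_eq_iff)
      then show False using bpf by (simp add: base_point_free_def)
    qed
  qed
  have nonvanishing: "\<forall>z\<in>tri n. c z = 0" if "ternary n c f = 0" for c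
  proof (rule ternary_eq_0_imp[OF bpf f3, of "range P"])
    show "\<exists>s. cross (pev f s) q \<noteq> 0" if q: "q \<in> range P" for q
    proof (rule ccontr)
      assume c: "\<not> ?thesis"
      obtain i where i: "q = P i" using q by blast
      have "pev (cross (cP i) f) s = - cross (pev f s) q" for s
        by (simp add: vec3_eq_iff i cP_def)
      then have "pev (cross (cP i) f) s = 0" for s using c by simp
      then have "cross (cP i) f = 0" by (rule pev_eq_0_imp)
      then have "h i *s g i = 0" by (simp add: h)
      moreover have "topc (e i) 0 = (0 :: 'k ^ 3)" by (simp add: vec_eq_iff)
      then have "g i \<noteq> 0" using g_bpf[of i] unfolding base_point_free_def by metis
      ultimately show False using h_nz[of i] by (simp add: vec_eq_iff)
    qed
    show "s = t" if "\<forall>q\<in>range P. cross (pev f s) q \<noteq> 0" "\<forall>q\<in>range P. cross (pev f t) q \<noteq> 0"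
      "cross (pev f s) (pev f t) = 0" for s t
      by (rule closed_immersion_injective[OF imm sub]) (use that in \<open>auto simp: f_def P_def\<close>)
    show "cross (pev f s) (pev (\<chi> i. pderiv (f$i)) s) \<noteq> 0" if "\<forall>q\<in>range P. cross (pev f s) q \<noteq> 0" for s
      unfolding f_def
      by (rule closed_immersion_immersive[OF imm sub]) (use that in \<open>auto simp: f_def P_def\<close>)
    show "n < d" using n by simp
    show "ternary n c f = 0" by fact
  qed (auto simp: P)
  obtain S where S: "syzygy f n S" "S \<noteq> 0"
  proof (rule ex_low_degree_syzygy[OF bpf _ u hm e(4) _ _ h_nz _ _ nonvanishing])
    show "i = j" if "p i $ 1 = p j $ 1" "p i $ 2 = p j $ 2" for i j
      using that generic_points_inj[OF assms(1), of i j] by (simp add: vector_2_eq_iff)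
    show "degree (g i $ 2) \<le> d - m i" "degree (- (g i $ 1)) \<le> d - m i" for i
      using g_bpf[of i] e(3)[of i] by (simp_all add: base_point_free_def degle_def)
    show "(\<Sum>i\<in>UNIV. k i * (k i + 1)) < n * (n + 2)"
      by (rule numerical_conditions(1)[OF sq k])
    show "n * d \<le> n + (\<Sum>i\<in>UNIV. k i * m i)"
      unfolding n by (rule numerical_conditions(2)[OF sq k])
  qed
  have "split_a E \<le> int n" "split_a E + split_b E = dot_L E"
    using splitting_type_le[OF mor(1)[unfolded \<phi>_def] S[unfolded f_def \<phi>_def]] by simp_all
  moreover have "dot_L E = 2 * int n + 2" using n by (simp add: dot_L_def d_def \<phi>_def)
  ultimately show ?thesis by (simp add: splitting_gap_def)
qed

end
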